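(* Let $T$ be a tournament on $n$ vertices and let $k,t\in \mathbb{N}$ with $t\geq 2$. If $T$ is strongly $10^7k^6t^3\log (kt^2)$-connected, then there exists a partition of $V(T)$ into $t$ vertex classes $V_1,\dots, V_t$ such that for all $i\in \{1,\dots, t\}$ the subtournament $T[V_i]$ is strongly $k$-connected.
   Context: A tournament is an orientation of a complete graph. A tournament is strongly connected if for every ordered pair of vertices $u,v$ there is a directed path from $u$ to $v$. For $k\in\mathbb{N}$, a tournament $T$ is strongly $k$-connected if $|V(T)|>k$ and the removal of any set of fewer than $k$ vertices results in a strongly connected tournament. $T[U]$ denotes the subtournament induced by $U\subseteq V(T)$. Here $\log$ denotes $\log_2$. *)

theory Defs
  imports Complex_Main
begin

definition tournament :: "'a set \<Rightarrow> ('a \<Rightarrow> 'a \<Rightarrow> bool) \<Rightarrow> bool" where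
  "tournament V E \<longleftrightarrow> finite V \<and> (\<forall>v\<in>V. \<not> E v v) \<and>
     (\<forall>u\<in>V. \<forall>v\<in>V. u \<noteq> v \<longrightarrow> (E u v \<longleftrightarrow> \<not> E v u))"

definition induced_arcs :: "'a set \<Rightarrow> ('a \<Rightarrow> 'a \<Rightarrow> bool) \<Rightarrow> 'a \<Rightarrow> 'a \<Rightarrow> bool" where
  "induced_arcs U E = (\<lambda>x y. x \<in> U \<and> y \<in> U \<and> E x y)"

definition strongly_connected :: "'a set \<Rightarrow> ('a \<Rightarrow> 'a \<Rightarrow> bool) \<Rightarrow> bool" where
  "strongly_connected U E \<longleftrightarrow> (\<forall>u\<in>U. \<forall>v\<in>U. (induced_arcs U E)\<^sup>*\<^sup>* u v)"

text \<open>T[U] is strongly c-connected (c real so that non-integer bounds are allowed literally):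
  |U| > c and deleting fewer than c vertices leaves a strongly connected tournament.\<close>
definition strongly_k_connected :: "'a set \<Rightarrow> ('a \<Rightarrow> 'a \<Rightarrow> bool) \<Rightarrow> real \<Rightarrow> bool" where
  "strongly_k_connected U E c \<longleftrightarrow> real (card U) > c \<and>
     (\<forall>S\<subseteq>U. real (card S) < c \<longrightarrow> strongly_connected (U - S) E)"

end

theory Submission
  imports Defs
begin

text \<open>For each orientation of the arcs, choose many vertices of small out-degree and grow from each a
  short chain \<open>A\<close> whose vertices all reach its tip, such that almost every vertex sends an arc into
  \<open>A\<close>. By Menger's theorem, part of the tips of the out-chains can be joined disjointly to tips of the
  in-chains. A chain pair together with its path is a structure; a class containing \<open>k\<close> structures
  is strongly \<open>k\<close>-connected once each of its few bad vertices (those that miss some chain) has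
  \<open>k\<close> better neighbours in the class. These neighbours are reserved disjointly and inherit the
  class of the vertex they serve.

  The danger is that the neighbours of a bad vertex \<open>w\<close> lie on paths of foreign classes. Take the
  system of paths of minimal total length and keep some tips unused. If an unused tip sends an arc
  to \<open>w\<close>, then a shortcut through \<open>w\<close> shows that \<open>w\<close> has at most three out-neighbours on each path;
  otherwise \<open>w\<close> sends arcs to all unused tips, which are distributed among the classes. The argument
  fails only for chain vertices and for the first and last two vertices of the paths. Only boundedly
  many paths meet the neighbours reserved for such a vertex, and a sparse selection of the paths
  ensures that at most one of those is kept.\<close>

section \<open>Menger's theorem\<close>

text \<open>Chains start at vertices of smallest degree in their orientation: the set missed by a
  chain then has at most \<open>d / 2 ^ c\<close> vertices outside the chains, where
  \<open>d\<close> is a degree that all vertices outside the starting sets reach. With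
  \<open>2 ^ c\<close> at least \<open>16 * k * m\<close>, the \<open>m\<close> missed sets together
  have at most \<open>d / (16 * k)\<close> vertices, so a bad vertex outside the starting sets keeps
  many neighbours that are not bad. A starting vertex may have degree only \<open>n\<close> and must
  accept bad neighbours; hence bad vertices get ranks, and neighbours are reserved in order of
  guaranteed degree. The connectivity actually consumed is \<open>16 * k * q\<close>. The sparse
  selection asks for \<open>M\<close> of order \<open>k ^ 3 * t * c\<close> walks, and
  \<open>2 * m\<close> chains of at most \<open>c + 2\<close> vertices give \<open>q\<close>. As
  \<open>c\<close> is of order \<open>log (k * t ^ 2)\<close>, this is \<open>k ^ 4 * t\<close>
  times a squared logarithm; bounding one logarithm by \<open>k * t ^ 2\<close> leaves
  \<open>k ^ 5 * t ^ 3\<close> times a logarithm.\<close>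

definition walk :: "('a \<Rightarrow> 'a \<Rightarrow> bool) \<Rightarrow> 'a list \<Rightarrow> bool" where
  "walk E p \<longleftrightarrow> p \<noteq> [] \<and> successively E p"

text \<open>Only different walks have to be disjoint; a single walk may revisit vertices, so no walk
  ever has to be reduced to a path.\<close>

definition linkage :: "('a \<Rightarrow> 'a \<Rightarrow> bool) \<Rightarrow> 'a set \<Rightarrow> 'a set \<Rightarrow> 'a list set \<Rightarrow> bool" where
  "linkage E X Y L \<longleftrightarrow> finite L \<and> (\<forall>p\<in>L. walk E p \<and> hd p \<in> X \<and> last p \<in> Y) \<and>
     (\<forall>p\<in>L. \<forall>q\<in>L. p \<noteq> q \<longrightarrow> set p \<inter> set q = {})"

lemma walk_mono: "walk E p \<Longrightarrow> (\<And>x y. x \<in> set p \<Longrightarrow> y \<in> set p \<Longrightarrow> E x y \<Longrightarrow> F x y) \<Longrightarrow> walk F p"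
  unfolding walk_def by (auto intro: successively_mono)

lemma walk_rev: "walk (\<lambda>x y. E y x) (rev p) \<longleftrightarrow> walk E p"
  by (simp add: walk_def)

lemma walk_prefix: "walk E (ys @ x # zs) \<Longrightarrow> walk E (ys @ [x])"
  by (auto simp: walk_def successively_append_iff)

lemma walk_suffix: "walk E (ys @ x # zs) \<Longrightarrow> walk E (x # zs)"
  by (auto simp: walk_def successively_append_iff)

lemma walk_join: "walk E (ys @ [x]) \<Longrightarrow> walk E (x # zs) \<Longrightarrow> walk E (ys @ x # zs)"
  by (auto simp: walk_def successively_append_iff)

lemma walk_join_edge: "walk E (ys @ [x]) \<Longrightarrow> walk E (y # zs) \<Longrightarrow> E x y \<Longrightarrow> walk E (ys @ x # y # zs)"
  by (auto simp: walk_def successively_append_iff successively_Cons)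

text \<open>The last vertex is exempt because no arc of the walk has to leave it. This fits a walk
  cut at its first visit to a set containing the tail of a deleted arc.\<close>

lemma walk_mono_snoc:
  assumes "walk E (ys @ [x])" "\<And>u v. u \<in> set ys \<Longrightarrow> E u v \<Longrightarrow> F u v"
  shows "walk F (ys @ [x])"
proof -
  have "ys = [] \<or> last ys \<in> set ys" by (cases ys) auto
  with assms show ?thesis
    by (fastforce simp: walk_def successively_append_iff intro: successively_mono)
qed

lemma walk_mono_Cons:
  assumes "walk E (x # zs)" "\<And>u v. v \<in> set zs \<Longrightarrow> E u v \<Longrightarrow> F u v"
  shows "walk F (x # zs)"
proof -
  have "zs = [] \<or> hd zs \<in> set zs" by (cases zs) auto
  with assms show ?thesis
    by (fastforce simp: walk_def successively_Cons intro: successively_mono)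
qed

lemma linkage_rev:
  assumes "linkage E X Y L"
  shows "linkage (\<lambda>x y. E y x) Y X (rev ` L)"
  using assms unfolding linkage_def
  by (auto simp: walk_rev hd_rev last_rev walk_def)

text \<open>Each walk is cut at its first visit to \<open>B\<close>; since there are as many walks as elements of \<open>B\<close>,
  every element of \<open>B\<close> is the end of exactly one walk.\<close>
lemma linkage_onto_family:
  assumes L: "linkage E X B L" and "finite B" and card: "card L = card B"
  obtains P where "\<And>s. s \<in> B \<Longrightarrow> walk E (P s @ [s]) \<and> hd (P s @ [s]) \<in> X \<and> set (P s) \<inter> B = {}"
    and "\<And>s r. s \<in> B \<Longrightarrow> r \<in> B \<Longrightarrow> s \<noteq> r \<Longrightarrow> set (P s @ [s]) \<inter> set (P r @ [r]) = {}"
proof -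
  have "\<exists>ys x. (\<exists>zs. p = ys @ x # zs) \<and> x \<in> B \<and> (\<forall>y\<in>set ys. y \<notin> B)" if "p \<in> L" for p
  proof -
    from L that have "p \<noteq> []" "last p \<in> B" by (auto simp: linkage_def walk_def)
    then have "\<exists>x\<in>set p. x \<in> B" by auto
    from split_list_first_prop[OF this] show ?thesis by blast
  qed
  then obtain Y x where Yx: "\<And>p. p \<in> L \<Longrightarrow> (\<exists>zs. p = Y p @ x p # zs) \<and> x p \<in> B \<and> (\<forall>y\<in>set (Y p). y \<notin> B)"
    by metis
  have disj: "p = q" if "p \<in> L" "q \<in> L" "v \<in> set p" "v \<in> set q" for p q v
    using L that by (auto simp: linkage_def)
  have sub: "set (Y p @ [x p]) \<subseteq> set p" if "p \<in> L" for p
  proof -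
    from Yx[OF that] obtain zs where "p = Y p @ x p # zs" by blast
    then have "set p = set (Y p @ x p # zs)" by simp
    then show ?thesis by auto
  qed
  have inj: "inj_on x L"
  proof (rule inj_onI)
    fix p q assume "p \<in> L" "q \<in> L" "x p = x q"
    then show "p = q" using disj[of p q "x p"] sub[of p] sub[of q] by auto
  qed
  have "x ` L = B"
    using Yx card_image[OF inj] card by (intro card_subset_eq) (auto simp: assms(2))
  define g where "g = inv_into L x"
  have g: "g s \<in> L \<and> x (g s) = s" if "s \<in> B" for s
    using that \<open>x ` L = B\<close> by (auto simp: g_def inv_into_into f_inv_into_f)
  have cut: "walk E (Y p @ [x p]) \<and> hd (Y p @ [x p]) \<in> X" if "p \<in> L" for p
  proof -
    from Yx[OF that] obtain zs where zs: "p = Y p @ x p # zs" by blast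
    have "walk E p" "hd p \<in> X" using L that by (auto simp: linkage_def)
    moreover have "hd p = hd (Y p @ [x p])" by (subst zs) (simp add: hd_append)
    ultimately show ?thesis using walk_prefix zs by metis
  qed
  define P where "P = (\<lambda>s. Y (g s))"
  show thesis
  proof
    fix s assume s: "s \<in> B"
    have "walk E (P s @ [s])" "hd (P s @ [s]) \<in> X"
      using cut[of "g s"] g[OF s] by (simp_all add: P_def)
    moreover have "set (P s) \<inter> B = {}" using Yx[of "g s"] g[OF s] by (auto simp: P_def)
    ultimately show "walk E (P s @ [s]) \<and> hd (P s @ [s]) \<in> X \<and> set (P s) \<inter> B = {}" by blast
  next
    fix s r assume sr: "s \<in> B" "r \<in> B" "s \<noteq> r"
    have "g s \<noteq> g r" using g[OF sr(1)] g[OF sr(2)] sr(3) by auto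
    then have "set (g s) \<inter> set (g r) = {}" using L g sr by (auto simp: linkage_def)
    then show "set (P s @ [s]) \<inter> set (P r @ [r]) = {}"
      using sub[of "g s"] sub[of "g r"] g[OF sr(1)] g[OF sr(2)] unfolding P_def by fastforce
  qed
qed

lemma linkage_from_family:
  assumes "finite B"
    and "\<And>s. s \<in> B \<Longrightarrow> walk E (W s) \<and> hd (W s) \<in> X \<and> last (W s) \<in> Y"
    and "\<And>s r. s \<in> B \<Longrightarrow> r \<in> B \<Longrightarrow> s \<noteq> r \<Longrightarrow> set (W s) \<inter> set (W r) = {}"
  shows "linkage E X Y (W ` B) \<and> card (W ` B) = card B"
proof
  show "linkage E X Y (W ` B)"
    unfolding linkage_def
  proof (intro conjI ballI impI)
    fix p q assume "p \<in> W ` B" "q \<in> W ` B" "p \<noteq> q"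
    then show "set p \<inter> set q = {}" using assms(3) by (metis imageE)
  qed (use assms in auto)
  have "inj_on W B"
  proof (rule inj_onI)
    fix s r assume sr: "s \<in> B" "r \<in> B" "W s = W r"
    have "W s \<noteq> []" using assms(2)[OF sr(1)] by (auto simp: walk_def)
    then show "s = r" using assms(3)[of s r] sr by (cases "W s") auto
  qed
  then show "card (W ` B) = card B" by (rule card_image)
qed

text \<open>Induction on the arcs, hence the relation is given as a finite set \<open>G\<close>. If
  deleting the arc from \<open>x\<close> to \<open>y\<close> creates a separator \<open>S\<close>
  with fewer than \<open>n\<close> vertices, then \<open>S\<close> with either end of the arc
  separates in the full graph and has exactly \<open>n\<close> vertices. Linkages up to it and
  beyond it exist without the arc and are glued along \<open>S\<close> and the arc.\<close>

theorem menger: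
  assumes "finite G" "finite X" "finite Y"
    and "\<And>S. finite S \<Longrightarrow> card S < n \<Longrightarrow>
      \<exists>p. walk (\<lambda>x y. (x, y) \<in> G) p \<and> hd p \<in> X \<and> last p \<in> Y \<and> set p \<inter> S = {}"
  shows "\<exists>L. linkage (\<lambda>x y. (x, y) \<in> G) X Y L \<and> card L = n"
  using assms
proof (induction G arbitrary: X Y rule: finite_induct)
  case empty
  have single: "\<exists>x. p = [x]" if "walk (\<lambda>x y. (x, y) \<in> {}) p" for p :: "'a list"
    using that by (cases p; cases "tl p") (auto simp: walk_def)
  \<comment> \<open>Without arcs a walk is a single vertex, so \<open>X \<inter> Y\<close> is itself
    a separator.\<close>
  have "n \<le> card (X \<inter> Y)"
  proof (rule ccontr)
    assume "\<not> n \<le> card (X \<inter> Y)"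
    then obtain p where "walk (\<lambda>x y. (x, y) \<in> {}) p" "hd p \<in> X" "last p \<in> Y" "set p \<inter> (X \<inter> Y) = {}"
      using empty(3)[of "X \<inter> Y"] empty(1) by auto
    with single[of p] show False by auto
  qed
  then obtain B where B: "B \<subseteq> X \<inter> Y" "card B = n" "finite B"
    by (meson obtain_subset_with_card_n)
  show ?case
    using linkage_from_family[OF B(3), of "\<lambda>x y. (x, y) \<in> {}" "\<lambda>s. [s]" X Y] B
    by (force simp: walk_def)
next
  case (insert e G)
  obtain x y where e: "e = (x, y)" by (cases e)
  let ?F = "\<lambda>u v. (u, v) \<in> insert e G" and ?G = "\<lambda>u v. (u, v) \<in> G"
  show ?case
  proof (cases "\<forall>S. finite S \<longrightarrow> card S < n \<longrightarrow>
      (\<exists>p. walk ?G p \<and> hd p \<in> X \<and> last p \<in> Y \<and> set p \<inter> S = {})")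
    case True
    then obtain L where "linkage ?G X Y L" "card L = n" using insert.IH[OF insert.prems(1,2)] by blast
    then show ?thesis unfolding linkage_def
      by (intro exI[of _ L]) (auto intro: walk_mono)
  next
    case False
    then obtain S where S: "finite S" "card S < n"
      and sep: "\<And>p. walk ?G p \<Longrightarrow> hd p \<in> X \<Longrightarrow> last p \<in> Y \<Longrightarrow> set p \<inter> S \<noteq> {}" by blast
    have sepx: "set p \<inter> insert x S \<noteq> {}" if "walk ?F p" "hd p \<in> X" "last p \<in> Y" for p
    proof
      assume "set p \<inter> insert x S = {}"
      then show False using sep[OF walk_mono[OF that(1)]] that e by auto
    qed
    have sepy: "set p \<inter> insert y S \<noteq> {}" if "walk ?F p" "hd p \<in> X" "last p \<in> Y" for p
    proof
      assume "set p \<inter> insert y S = {}"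
      then show False using sep[OF walk_mono[OF that(1)]] that e by auto
    qed
    have "\<not> card (insert x S) < n" "\<not> card (insert y S) < n"
      using insert.prems(3)[of "insert x S"] insert.prems(3)[of "insert y S"] sepx sepy S by blast+
    then have xy: "x \<notin> S" "y \<notin> S" and cS: "card (insert x S) = n" "card (insert y S) = n"
      using S by (auto simp: card_insert_if split: if_splits)
    \<comment> \<open>A set separating \<open>X\<close> from \<open>insert x S\<close> without the
      new arc would separate \<open>X\<close> from \<open>Y\<close> with it: up to its first visit
      to \<open>insert x S\<close> a walk never leaves \<open>x\<close>, so it does not use the new
      arc.\<close>
    have "\<exists>L. linkage ?G X (insert x S) L \<and> card L = n"
    proof (rule insert.IH)
      fix S' :: "'a set" assume "finite S'" "card S' < n"
      from insert.prems(3)[OF this] obtain p where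
        p: "walk ?F p" "hd p \<in> X" "last p \<in> Y" "set p \<inter> S' = {}" by blast
      with sepx[of p] have "\<exists>v\<in>set p. v \<in> insert x S" by blast
      from split_list_first_prop[OF this] obtain ys v zs where
        v: "p = ys @ v # zs" "v \<in> insert x S" "\<forall>w\<in>set ys. w \<notin> insert x S" by blast
      have "walk ?F (ys @ [v])" using p v walk_prefix by metis
      then have "walk ?G (ys @ [v])" by (rule walk_mono_snoc) (use v(3) e in auto)
      then show "\<exists>p. walk ?G p \<and> hd p \<in> X \<and> last p \<in> insert x S \<and> set p \<inter> S' = {}"
        using p v by (intro exI[of _ "ys @ [v]"]) (auto simp: hd_append)
    qed (use insert S in auto)
    then obtain L1 where L1: "linkage ?G X (insert x S) L1" "card L1 = n" by blast
    have "\<exists>L. linkage ?G (insert y S) Y L \<and> card L = n"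
    proof (rule insert.IH)
      fix S' :: "'a set" assume "finite S'" "card S' < n"
      from insert.prems(3)[OF this] obtain p where
        p: "walk ?F p" "hd p \<in> X" "last p \<in> Y" "set p \<inter> S' = {}" by blast
      with sepy[of p] have "\<exists>v\<in>set p. v \<in> insert y S" by blast
      from split_list_last_prop[OF this] obtain ys v zs where
        v: "p = ys @ v # zs" "v \<in> insert y S" "\<forall>w\<in>set zs. w \<notin> insert y S" by blast
      have "walk ?F (v # zs)" using p v walk_suffix by metis
      then have "walk ?G (v # zs)" by (rule walk_mono_Cons) (use v(3) e in auto)
      then show "\<exists>p. walk ?G p \<and> hd p \<in> insert y S \<and> last p \<in> Y \<and> set p \<inter> S' = {}"
        using p v by (intro exI[of _ "v # zs"]) (auto simp: hd_append)
    qed (use insert S in auto)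
    then obtain L2 where L2: "linkage ?G (insert y S) Y L2" "card L2 = n" by blast
    obtain P where P: "\<And>s. s \<in> insert x S \<Longrightarrow> walk ?G (P s @ [s]) \<and> hd (P s @ [s]) \<in> X \<and> set (P s) \<inter> insert x S = {}"
      and Pd: "\<And>s r. s \<in> insert x S \<Longrightarrow> r \<in> insert x S \<Longrightarrow> s \<noteq> r \<Longrightarrow> set (P s @ [s]) \<inter> set (P r @ [r]) = {}"
      using linkage_onto_family[OF L1(1)] L1(2) cS S by (metis finite_insert)
    have rl: "linkage (\<lambda>u v. ?G v u) Y (insert y S) (rev ` L2)" using linkage_rev[OF L2(1)] .
    have "card (rev ` L2) = card (insert y S)"
      using L2(2) cS by (simp add: card_image)
    from linkage_onto_family[OF rl _ this] S obtain Q where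
      Q: "\<And>s. s \<in> insert y S \<Longrightarrow> walk (\<lambda>u v. ?G v u) (Q s @ [s]) \<and> hd (Q s @ [s]) \<in> Y \<and> set (Q s) \<inter> insert y S = {}"
      and Qd: "\<And>s r. s \<in> insert y S \<Longrightarrow> r \<in> insert y S \<Longrightarrow> s \<noteq> r \<Longrightarrow> set (Q s @ [s]) \<inter> set (Q r @ [r]) = {}"
      by (metis finite_insert)
    have Q': "walk ?G (s # rev (Q s)) \<and> last (s # rev (Q s)) \<in> Y" if "s \<in> insert y S" for s
      using Q[OF that] walk_rev[of ?G "s # rev (Q s)"] by (auto simp: last_rev hd_append split: if_splits)
    \<comment> \<open>A vertex shared by a left and a right walk yields a walk from \<open>X\<close>
      to \<open>Y\<close> in \<open>G\<close>, which must meet \<open>S\<close>. Its parts before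
      and after \<open>v\<close> avoid \<open>S\<close>, so \<open>v\<close> is in \<open>S\<close>
      and is the end at which both walks were cut.\<close>
    have cross: "v \<in> S \<and> v = s \<and> v = r"
      if s: "s \<in> insert x S" and r: "r \<in> insert y S" and v: "v \<in> set (P s @ [s])" "v \<in> set (Q r @ [r])" for s r v
    proof -
      from split_list_first[OF v(1)] obtain a b where ab: "P s @ [s] = a @ v # b" "v \<notin> set a" by blast
      have "v \<in> set (r # rev (Q r))" using v(2) by auto
      from split_list_last[OF this] obtain a' b' where ab': "r # rev (Q r) = a' @ v # b'" "v \<notin> set b'" by blast
      have sa: "set a \<subseteq> set (P s)" using ab by (cases b rule: rev_cases) auto
      have sb: "set b' \<subseteq> set (Q r)"
      proof -
        have "set b' \<subseteq> set (rev (Q r))"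
        proof (cases a')
          case Nil
          with ab' have "rev (Q r) = b'" by auto
          from arg_cong[OF this, of set] show ?thesis by auto
        next
          case (Cons u us)
          with ab' have "rev (Q r) = us @ v # b'" by auto
          from arg_cong[OF this, of set] show ?thesis by auto
        qed
        then show ?thesis by simp
      qed
      have "walk ?G (a @ [v])" using P[OF s] ab walk_prefix by metis
      moreover have "walk ?G (v # b')" using Q'[OF r] ab' walk_suffix by metis
      ultimately have w: "walk ?G (a @ v # b')" by (rule walk_join)
      have h: "hd (a @ v # b') \<in> X" using P[OF s] unfolding ab by (simp add: hd_append split: if_splits)
      have "last (r # rev (Q r)) = last (v # b')" unfolding ab' by simp
      then have l: "last (a @ v # b') \<in> Y" using Q'[OF r] by simp
      have "set (a @ v # b') \<inter> S \<noteq> {}" by (rule sep[OF w h l])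
      then have "v \<in> S" using P[OF s] Q[OF r] sa sb by auto
      then show ?thesis using v P[OF s] Q[OF r] by auto
    qed
    \<comment> \<open>The left walk ending in \<open>x\<close> continues over the new arc into the
      right walk of \<open>y\<close>; all others are joined at their common vertex in
      \<open>S\<close>.\<close>
    let ?W = "\<lambda>s. if s = x then P x @ x # y # rev (Q y) else P s @ s # rev (Q s)"
    have "linkage ?F X Y (?W ` insert x S) \<and> card (?W ` insert x S) = card (insert x S)"
    proof (rule linkage_from_family)
      fix s assume s: "s \<in> insert x S"
      show "walk ?F (?W s) \<and> hd (?W s) \<in> X \<and> last (?W s) \<in> Y"
      proof (cases "s = x")
        case True
        have "walk ?F (P x @ [x])" using P[of x] walk_mono[of ?G "P x @ [x]" ?F] by auto
        moreover have "walk ?F (y # rev (Q y))" using Q'[of y] walk_mono[of ?G "y # rev (Q y)" ?F] by auto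
        ultimately have "walk ?F (P x @ x # y # rev (Q y))" by (rule walk_join_edge) (simp add: e)
        then show ?thesis using True P[of x] Q'[of y] by (auto simp: hd_append split: if_splits)
      next
        case False
        with s have "s \<in> insert y S" by simp
        with P[OF s] Q'[of s] have "walk ?G (P s @ s # rev (Q s))" by (blast intro: walk_join)
        then have "walk ?F (P s @ s # rev (Q s))" by (rule walk_mono) auto
        then show ?thesis using False P[OF s] Q'[OF \<open>s \<in> insert y S\<close>] by (auto simp: hd_append split: if_splits)
      qed
    next
      fix s r assume sr: "s \<in> insert x S" "r \<in> insert x S" "s \<noteq> r"
      define s' r' where "s' = (if s = x then y else s)" and "r' = (if r = x then y else r)"
      have sr': "s' \<in> insert y S" "r' \<in> insert y S" "s' \<noteq> r'"
        using sr xy by (auto simp: s'_def r'_def)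
      have W: "set (?W s) = set (P s @ [s]) \<union> set (Q s' @ [s'])" "set (?W r) = set (P r @ [r]) \<union> set (Q r' @ [r'])"
        using sr by (auto simp: s'_def r'_def)
      have c1: "set (P s @ [s]) \<inter> set (Q r' @ [r']) = {}"
      proof (rule ccontr)
        assume "\<not> ?thesis"
        then obtain v where v: "v \<in> set (P s @ [s])" "v \<in> set (Q r' @ [r'])" by blast
        from cross[OF sr(1) sr'(2) v] have "s \<in> S" "s = r'" by auto
        then show False using sr xy by (auto simp: r'_def split: if_splits)
      qed
      have c2: "set (P r @ [r]) \<inter> set (Q s' @ [s']) = {}"
      proof (rule ccontr)
        assume "\<not> ?thesis"
        then obtain v where v: "v \<in> set (P r @ [r])" "v \<in> set (Q s' @ [s'])" by blast
        from cross[OF sr(2) sr'(1) v] have "r \<in> S" "r = s'" by auto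
        then show False using sr xy by (auto simp: s'_def split: if_splits)
      qed
      show "set (?W s) \<inter> set (?W r) = {}"
        unfolding W using Pd[OF sr] Qd[OF sr'] c1 c2 by blast
    qed (use S in auto)
    then show ?thesis using cS by blast
  qed
qed

section \<open>Walks and reachability\<close>

abbreviation reach :: "'a set \<Rightarrow> ('a \<Rightarrow> 'a \<Rightarrow> bool) \<Rightarrow> 'a \<Rightarrow> 'a \<Rightarrow> bool" where
  "reach U E \<equiv> (induced_arcs U E)\<^sup>*\<^sup>*"

lemma reach_mono: "reach A E u v \<Longrightarrow> A \<subseteq> B \<Longrightarrow> reach B E u v"
  by (erule rtranclp_mono[THEN predicate2D, rotated]) (auto simp: induced_arcs_def)

lemma reach_step: "E u w \<Longrightarrow> u \<in> B \<Longrightarrow> w \<in> B \<Longrightarrow> reach B E w v \<Longrightarrow> reach B E u v"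
  by (rule converse_rtranclp_into_rtranclp) (auto simp: induced_arcs_def)

lemma reach_converse: "reach B (\<lambda>x y. E y x) u v \<longleftrightarrow> reach B E v u"
proof -
  have "induced_arcs B (\<lambda>x y. E y x) = (induced_arcs B E)\<inverse>\<inverse>"
    by (auto simp: induced_arcs_def fun_eq_iff)
  then show ?thesis by (simp add: rtranclp_conversep)
qed

lemma reach_walk: "walk E p \<Longrightarrow> set p \<subseteq> B \<Longrightarrow> reach B E (hd p) (last p)"
proof (induction p)
  case (Cons x p)
  show ?case
  proof (cases "p = []")
    case False
    then have "walk E p" "E x (hd p)" using Cons.prems(1) by (auto simp: walk_def successively_Cons)
    then show ?thesis using Cons False by (auto intro!: reach_step[of E x "hd p"])
  qed simp
qed (simp add: walk_def)

lemma walk_if_reach: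
  assumes "reach B E u v" "u \<in> B"
  shows "\<exists>p. walk E p \<and> hd p = u \<and> last p = v \<and> set p \<subseteq> B"
  using assms
proof (induction rule: converse_rtranclp_induct)
  case base
  then show ?case by (intro exI[of _ "[v]"]) (auto simp: walk_def)
next
  case (step y z)
  then obtain p where "walk E p" "hd p = z" "last p = v" "set p \<subseteq> B"
    by (auto simp: induced_arcs_def)
  then show ?case using step.hyps step.prems
    by (intro exI[of _ "y # p"]) (auto simp: walk_def successively_Cons induced_arcs_def)
qed

section \<open>Dominating chains\<close>

lemma tournament_converse: "tournament V E \<Longrightarrow> tournament V (\<lambda>x y. E y x)"
  unfolding tournament_def by blast

text \<open>The out-degrees inside \<open>W\<close> sum to \<open>card W * (card W - 1) / 2\<close>,
  so their average is below half of \<open>card W\<close>.\<close>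

lemma tournament_half_outdegree:
  assumes T: "tournament V E" and W: "W \<subseteq> V" "W \<noteq> {}"
  shows "\<exists>v\<in>W. 2 * card {w\<in>W. E v w} \<le> card W"
proof (rule ccontr)
  assume neg: "\<not> ?thesis"
  have fin: "finite W" using T W finite_subset by (auto simp: tournament_def)
  have "(\<Sum>v\<in>W. card {w\<in>W. E v w}) = (\<Sum>v\<in>W. \<Sum>w\<in>W. if E v w then 1 else 0)"
    using fin by (simp add: sum.If_cases Int_def)
  also have "\<dots> = (\<Sum>w\<in>W. \<Sum>v\<in>W. if E v w then 1 else 0)" by (rule sum.swap)
  also have "\<dots> = (\<Sum>w\<in>W. card {v\<in>W. E v w})" using fin by (simp add: sum.If_cases Int_def)
  finally have sw: "(\<Sum>v\<in>W. card {w\<in>W. E v w}) = (\<Sum>v\<in>W. card {w\<in>W. E w v})" .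
  have "card {w\<in>W. E v w} + card {w\<in>W. E w v} = card W - 1" if "v \<in> W" for v
  proof -
    have "{w\<in>W. E v w} \<union> {w\<in>W. E w v} = W - {v}" "{w\<in>W. E v w} \<inter> {w\<in>W. E w v} = {}"
      using T W that unfolding tournament_def by (auto, metis subsetD)
    then have "card {w\<in>W. E v w} + card {w\<in>W. E w v} = card (W - {v})"
      using card_Un_disjoint[of "{w\<in>W. E v w}" "{w\<in>W. E w v}"] fin by simp
    then show ?thesis using that fin by simp
  qed
  then have "(\<Sum>v\<in>W. card {w\<in>W. E v w} + card {w\<in>W. E w v}) = card W * (card W - 1)" by simp
  then have "2 * (\<Sum>v\<in>W. card {w\<in>W. E v w}) = card W * (card W - 1)"
    by (simp add: sum.distrib sw)
  moreover have "2 * (\<Sum>v\<in>W. card {w\<in>W. E v w}) \<ge> card W * (card W)"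
  proof -
    have "(\<Sum>v\<in>W. card W) \<le> (\<Sum>v\<in>W. 2 * card {w\<in>W. E v w})"
      using neg by (intro sum_mono) (auto simp: not_le less_imp_le)
    then show ?thesis by (simp add: sum_distrib_left)
  qed
  moreover have "card W > 0" using fin W by (simp add: card_gt_0_iff)
  ultimately show False by (cases "card W") auto
qed

text \<open>Greedily picking vertices of small out-degree, each inside the out-neighbourhood of the
  previous ones, halves the set of vertices that send no arc to \<open>A\<close>.\<close>
lemma dominating_chain:
  assumes T: "tournament V E" and "W \<subseteq> V" "W \<noteq> {}"
  shows "\<exists>A a. A \<subseteq> W \<and> card A \<le> Suc c \<and> a \<in> A \<and> (\<forall>v\<in>A. reach A E v a) \<and>
    card {w\<in>W - A. \<forall>v\<in>A. \<not> E w v} * 2 ^ c \<le> card W"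
  using assms(2,3)
proof (induction c arbitrary: W)
  case 0
  then obtain v where "v \<in> W" by blast
  have fin: "finite W" using T 0 finite_subset by (auto simp: tournament_def)
  have "card {w\<in>W - {v}. \<forall>v\<in>{v}. \<not> E w v} \<le> card W"
    by (rule card_mono) (use fin in auto)
  then show ?case using \<open>v \<in> W\<close> by (intro exI[of _ "{v}"] exI[of _ v]) auto
next
  case (Suc c)
  have fin: "finite W" using T Suc.prems finite_subset by (auto simp: tournament_def)
  from tournament_half_outdegree[OF T Suc.prems] obtain v where
    v: "v \<in> W" "2 * card {w\<in>W. E v w} \<le> card W" by blast
  let ?W = "{w\<in>W. E v w}"
  \<comment> \<open>Apart from \<open>v\<close>, the vertices of \<open>W\<close> outside
    \<open>?W\<close> send an arc to \<open>v\<close>; only those in \<open>?W\<close> remain to be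
    dominated.\<close>
  have outW: "w \<in> ?W" if "w \<in> W" "w \<noteq> v" "\<not> E w v" for w
    using T that v(1) Suc.prems(1) unfolding tournament_def by auto
  show ?case
  proof (cases "?W = {}")
    case True
    then have "{w\<in>W - {v}. \<forall>v\<in>{v}. \<not> E w v} = {}" using outW by blast
    then have "card {w\<in>W - {v}. \<forall>v\<in>{v}. \<not> E w v} * 2 ^ Suc c \<le> card W"
      by (simp only: card.empty mult_0 le0)
    then show ?thesis using v(1) by (intro exI[of _ "{v}"] exI[of _ v] conjI) (assumption | simp)+
  next
    case False
    have "?W \<subseteq> V" using Suc.prems by auto
    from Suc.IH[OF this False] obtain A a where A: "A \<subseteq> ?W" "card A \<le> Suc c" "a \<in> A"
      "\<And>u. u \<in> A \<Longrightarrow> reach A E u a"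
      and res: "card {w\<in>?W - A. \<forall>v\<in>A. \<not> E w v} * 2 ^ c \<le> card ?W" by blast
    have "finite A" using A(1) fin finite_subset by fastforce
    have r: "reach (insert v A) E u a" if "u \<in> insert v A" for u
    proof (cases "u \<in> A")
      case True then show ?thesis using A(4)[of u] reach_mono[of A E u a "insert v A"] by blast
    next
      case False
      then have "E u a" using that A by auto
      then show ?thesis using that A by (intro reach_step[of E u a]) auto
    qed
    have "{w\<in>W - insert v A. \<forall>u\<in>insert v A. \<not> E w u} \<subseteq> {w\<in>?W - A. \<forall>v\<in>A. \<not> E w v}"
      using outW by blast
    then have "card {w\<in>W - insert v A. \<forall>u\<in>insert v A. \<not> E w u} \<le> card {w\<in>?W - A. \<forall>v\<in>A. \<not> E w v}"
      using fin by (intro card_mono) auto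
    then have "card {w\<in>W - insert v A. \<forall>u\<in>insert v A. \<not> E w u} * 2 ^ Suc c
        \<le> card {w\<in>?W - A. \<forall>v\<in>A. \<not> E w v} * 2 ^ Suc c" by (rule mult_right_mono) simp
    also have "\<dots> \<le> 2 * card ?W" using res by simp
    also have "\<dots> \<le> card W" by (rule v(2))
    finally show ?thesis using A r v(1) \<open>finite A\<close>
      by (intro exI[of _ "insert v A"] exI[of _ a]) (auto simp: card_insert_if)
  qed
qed

text \<open>Vertices outside the neighbourhood of \<open>z\<close> already send an arc to
  \<open>z\<close>, so only that neighbourhood is halved and the leftover is measured against the
  degree of \<open>z\<close> instead of \<open>card V\<close>. The degree hypothesis leaves room
  next to \<open>Z\<close> and all earlier chains. The relation depends on \<open>z\<close>, so that
  chains of both orientations form one disjoint family.\<close>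

lemma chain_family:
  assumes Z: "finite Z" "Z \<subseteq> V"
    and T: "\<And>z. z \<in> Z \<Longrightarrow> tournament V (rel z)"
    and deg: "\<And>z. z \<in> Z \<Longrightarrow> card Z * (c + 3) < card {w\<in>V. rel z z w}"
  shows "\<exists>A tip. (\<forall>z\<in>Z. A z \<subseteq> V \<and> card (A z) \<le> c + 2 \<and> z \<in> A z \<and> tip z \<in> A z \<and> tip z \<noteq> z \<and>
      (\<forall>v\<in>A z. reach (A z) (rel z) v (tip z)) \<and>
      card {w\<in>V - \<Union>(A ` Z). \<forall>v\<in>A z. \<not> rel z w v} * 2 ^ c \<le> card {w\<in>V. rel z z w}) \<and>
    (\<forall>z\<in>Z. \<forall>y\<in>Z. z \<noteq> y \<longrightarrow> A z \<inter> A y = {})"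
proof -
  \<comment> \<open>The invariant \<open>A z \<inter> Z = {z}\<close> keeps the later starting
    vertices free. Leftovers are counted outside \<open>Z\<close> and the chains built so far, so
    they can only shrink when a chain is added.\<close>
  define good where "good = (\<lambda>Y A tip z. A z \<subseteq> V \<and> card (A z) \<le> c + 2 \<and> A z \<inter> Z = {z} \<and> tip z \<in> A z \<and> tip z \<noteq> z \<and>
      (\<forall>v\<in>A z. reach (A z) (rel z) v (tip z)) \<and>
      card {w\<in>V - (Z \<union> \<Union>(A ` Y)). \<forall>v\<in>A z. \<not> rel z w v} * 2 ^ c \<le> card {w\<in>V. rel z z w})"
  have "\<exists>A tip. (\<forall>z\<in>Y. good Y A tip z) \<and> (\<forall>z\<in>Y. \<forall>y\<in>Y. z \<noteq> y \<longrightarrow> A z \<inter> A y = {})"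
    if "finite Y" "Y \<subseteq> Z" for Y
    using that
  proof (induction Y)
    case (insert z Y)
    then obtain A tip where good: "\<forall>y\<in>Y. good Y A tip y"
      and disj: "\<And>x y. x \<in> Y \<Longrightarrow> y \<in> Y \<Longrightarrow> x \<noteq> y \<Longrightarrow> A x \<inter> A y = {}" by auto
    note IH = bspec[OF good, unfolded good_def]
    have zZ: "z \<in> Z" using insert.prems by auto
    note Tz = T[OF zZ]
    have finV: "finite V" using Tz by (simp add: tournament_def)
    let ?F = "Z \<union> \<Union>(A ` Y)"
    let ?N = "{w\<in>V. rel z z w}"
    let ?W = "?N - ?F"
    have finF: "finite ?F"
    proof -
      have "finite (A y)" if "y \<in> Y" for y using IH[OF that] finV finite_subset by blast
      then show ?thesis using Z insert.hyps by auto
    qed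
    have "card ?F \<le> card Z + card (\<Union>(A ` Y))" by (rule card_Un_le)
    also have "card (\<Union>(A ` Y)) \<le> (\<Sum>y\<in>Y. card (A y))" by (rule card_UN_le[OF insert.hyps(1)])
    also have "\<dots> \<le> card Y * (c + 2)" using sum_bounded_above[of Y "\<lambda>y. card (A y)" "c + 2"] IH by simp
    also have "\<dots> \<le> card Z * (c + 2)" using insert.prems Z card_mono[of Z Y] by (intro mult_right_mono) auto
    finally have "card ?F \<le> card Z * (c + 3)" by (simp add: algebra_simps)
    then have "card ?F < card ?N" using deg[OF zZ] by simp
    then have ne: "?W \<noteq> {}" using card_mono[OF finF, of ?N] by auto
    have "?W \<subseteq> V" by auto
    from dominating_chain[OF Tz this ne, of c] obtain B b where
      B: "B \<subseteq> ?W" "card B \<le> Suc c" "b \<in> B" "\<forall>v\<in>B. reach B (rel z) v b"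
      and res: "card {w\<in>?W - B. \<forall>v\<in>B. \<not> rel z w v} * 2 ^ c \<le> card ?W"
      by (elim exE conjE) (rule that)
    have finB: "finite B" by (rule finite_subset[OF B(1)]) (use finV in simp)
    define A' where "A' = A(z := insert z B)"
    define tip' where "tip' = tip(z := b)"
    have A'z: "A' z = insert z B" and tip'z: "tip' z = b" by (auto simp: A'_def tip'_def)
    have A'y: "A' y = A y" "tip' y = tip y" if "y \<in> Y" for y
      using that insert.hyps by (auto simp: A'_def tip'_def)
    have U: "\<Union>(A' ` insert z Y) = insert z B \<union> \<Union>(A ` Y)" using A'z A'y by auto
    have disjz: "A' z \<inter> A y = {}" if "y \<in> Y" for y
    proof -
      have "A y \<inter> Z = {y}" using IH[OF that] by (elim conjE)
      then have "z \<notin> A y" using zZ that insert.hyps(2) by fast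
      moreover have "B \<inter> A y = {}" using B(1) that by fast
      ultimately show ?thesis unfolding A'z by fast
    qed
    show ?case
    proof (intro exI[of _ A'] exI[of _ tip'] conjI ballI)
      fix y assume "y \<in> insert z Y"
      show "good (insert z Y) A' tip' y"
      proof (cases "y = z")
        case True
        have "z \<notin> B" using B(1) zZ by auto
        have r: "reach (insert z B) (rel z) v b" if "v \<in> insert z B" for v
        proof (cases "v \<in> B")
          case True then show ?thesis using B(4) reach_mono[of B "rel z" v b "insert z B"] by blast
        next
          case False
          then have "rel z v b" using that B by auto
          then show ?thesis using that B by (intro reach_step[of "rel z" v b]) auto
        qed
        have "{w\<in>V - (Z \<union> (insert z B \<union> \<Union>(A ` Y))). \<forall>v\<in>insert z B. \<not> rel z w v}
            \<subseteq> {w\<in>?W - B. \<forall>v\<in>B. \<not> rel z w v}"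
          using Tz zZ Z(2) unfolding tournament_def by auto
        then have "card {w\<in>V - (Z \<union> (insert z B \<union> \<Union>(A ` Y))). \<forall>v\<in>insert z B. \<not> rel z w v} * 2 ^ c
            \<le> card {w\<in>?W - B. \<forall>v\<in>B. \<not> rel z w v} * 2 ^ c"
          using finV by (intro mult_right_mono card_mono) auto
        also have "\<dots> \<le> card ?W" by (rule res)
        also have "card ?W \<le> card ?N" using finV by (intro card_mono) auto
        finally have "card {w\<in>V - (Z \<union> \<Union>(A' ` insert z Y)). \<forall>v\<in>A' z. \<not> rel z w v} * 2 ^ c \<le> card ?N"
          unfolding U A'z .
        moreover have "insert z B \<subseteq> V" "insert z B \<inter> Z = {z}" using B(1) zZ Z by auto
        moreover have "card (insert z B) \<le> c + 2" using B(2) finB \<open>z \<notin> B\<close> by simp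
        moreover have "b \<noteq> z" using B(3) \<open>z \<notin> B\<close> by auto
        ultimately show ?thesis using r B(3) unfolding good_def True A'z tip'z by blast
      next
        case False
        then have y: "y \<in> Y" using \<open>y \<in> insert z Y\<close> by auto
        have "card {w\<in>V - (Z \<union> \<Union>(A' ` insert z Y)). \<forall>v\<in>A y. \<not> rel y w v}
          \<le> card {w\<in>V - (Z \<union> \<Union>(A ` Y)). \<forall>v\<in>A y. \<not> rel y w v}"
          unfolding U using finV by (intro card_mono) auto
        then have "card {w\<in>V - (Z \<union> \<Union>(A' ` insert z Y)). \<forall>v\<in>A y. \<not> rel y w v} * 2 ^ c
          \<le> card {w\<in>V - (Z \<union> \<Union>(A ` Y)). \<forall>v\<in>A y. \<not> rel y w v} * 2 ^ c" by (rule mult_right_mono) simp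
        also have "\<dots> \<le> card {w\<in>V. rel y y w}" using IH[OF y] by blast
        finally show ?thesis using IH[OF y] unfolding good_def A'y[OF y] by blast
      qed
    next
      fix x y assume "x \<in> insert z Y" "y \<in> insert z Y"
      then show "x \<noteq> y \<longrightarrow> A' x \<inter> A' y = {}"
        using disj disjz A'y by (metis Int_commute insertE)
    qed
  qed auto
  from this[of Z] Z obtain A tip where good: "\<forall>z\<in>Z. good Z A tip z"
    and d: "\<forall>z\<in>Z. \<forall>y\<in>Z. z \<noteq> y \<longrightarrow> A z \<inter> A y = {}" by auto
  note A = bspec[OF good, unfolded good_def]
  have "Z \<union> \<Union>(A ` Z) = \<Union>(A ` Z)" using A by blast
  then have A2: "card {w\<in>V - \<Union>(A ` Z). \<forall>v\<in>A z. \<not> rel z w v} * 2 ^ c \<le> card {w\<in>V. rel z z w}" if "z \<in> Z" for z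
    using A[OF that] by simp
  have "z \<in> A z" if "z \<in> Z" for z using A[OF that] by blast
  then show ?thesis using A A2 d by (intro exI[of _ A] exI[of _ tip]) blast
qed

section \<open>Selection lemmas\<close>

text \<open>Applied to degrees: the threshold \<open>d\<close> bounds the degrees of the starting
  vertices from above and all remaining degrees from below, which relates the leftovers of the
  chains to the degrees of all other vertices.\<close>

lemma lowest_subset:
  fixes f :: "'a \<Rightarrow> nat"
  assumes "finite V" "m \<le> card V" "\<And>v. v \<in> V \<Longrightarrow> n \<le> f v"
  shows "\<exists>Z d. Z \<subseteq> V \<and> card Z = m \<and> n \<le> d \<and> (\<forall>z\<in>Z. f z \<le> d) \<and> (\<forall>w\<in>V - Z. d \<le> f w)"
  using assms(2)
proof (induction m)
  case 0
  then show ?case using assms(3) by (intro exI[of _ "{}"] exI[of _ n]) auto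
next
  case (Suc m)
  then obtain Z d where Z: "Z \<subseteq> V" "card Z = m" "n \<le> d" "\<forall>z\<in>Z. f z \<le> d" "\<forall>w\<in>V - Z. d \<le> f w" by auto
  have "finite Z" using Z(1) assms(1) finite_subset by blast
  have "V - Z \<noteq> {}" using Z Suc.prems card_mono[OF \<open>finite Z\<close>, of V] by auto
  then obtain v where v: "v \<in> V - Z" "\<And>w. w \<in> V - Z \<Longrightarrow> f v \<le> f w"
    using arg_min_if_finite(1)[of "V - Z" f] arg_min_least[of "V - Z" _ f] assms(1) by blast
  have "d \<le> f v" using Z(5) v(1) by blast
  then have "\<forall>z\<in>insert v Z. f z \<le> f v" using Z(4) le_trans by blast
  moreover have "n \<le> f v" using \<open>d \<le> f v\<close> Z(3) by simp
  moreover have "\<forall>w\<in>V - insert v Z. f v \<le> f w" using v(2) by blast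
  moreover have "insert v Z \<subseteq> V" "card (insert v Z) = Suc m" using Z v(1) \<open>finite Z\<close> by auto
  ultimately show ?case by blast
qed

text \<open>Serve the requests greedily by increasing \<open>\<tau>\<close>: when \<open>q\<close>
  is served, only requests of no larger \<open>\<tau>\<close> have taken elements, \<open>k\<close>
  each.\<close>

lemma disjoint_representatives:
  fixes \<tau> :: "'q \<Rightarrow> nat"
  assumes "finite Q"
    and "\<And>q. q \<in> Q \<Longrightarrow> k * card {r\<in>Q. \<tau> r \<le> \<tau> q} \<le> card (C q)"
  shows "\<exists>R. (\<forall>q\<in>Q. R q \<subseteq> C q \<and> finite (R q) \<and> card (R q) = k) \<and> (\<forall>q\<in>Q. \<forall>r\<in>Q. q \<noteq> r \<longrightarrow> R q \<inter> R r = {})"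
  using assms
proof (induction Q rule: finite_ranking_induct[where f = \<tau>])
  case (insert x S)
  show ?case
  proof (cases "x \<in> S")
    case True
    then show ?thesis using insert by (simp add: insert_absorb)
  next
    case False
    have "k * card {r\<in>S. \<tau> r \<le> \<tau> q} \<le> card (C q)" if "q \<in> S" for q
    proof -
      have "card {r\<in>S. \<tau> r \<le> \<tau> q} \<le> card {r\<in>insert x S. \<tau> r \<le> \<tau> q}"
        using insert(1) by (intro card_mono) auto
      then have "k * card {r\<in>S. \<tau> r \<le> \<tau> q} \<le> k * card {r\<in>insert x S. \<tau> r \<le> \<tau> q}" by simp
      also have "\<dots> \<le> card (C q)" using insert(4) that by blast
      finally show ?thesis .
    qed
    from insert(3)[OF this] obtain R where
      R: "\<forall>q\<in>S. R q \<subseteq> C q \<and> finite (R q) \<and> card (R q) = k"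
      and disj: "\<forall>q\<in>S. \<forall>r\<in>S. q \<noteq> r \<longrightarrow> R q \<inter> R r = {}" by blast
    have "{r\<in>insert x S. \<tau> r \<le> \<tau> x} = insert x S" using insert(2) by auto
    then have c: "k * Suc (card S) \<le> card (C x)" using insert(4)[of x] insert(1) False by simp
    have "card (\<Union>(R ` S)) \<le> (\<Sum>q\<in>S. card (R q))" by (rule card_UN_le[OF insert(1)])
    also have "\<dots> = k * card S" using R by simp
    finally have u: "card (\<Union>(R ` S)) \<le> k * card S" .
    have "finite (\<Union>(R ` S))" using R insert(1) by auto
    then have "card (C x) - card (\<Union>(R ` S)) \<le> card (C x - \<Union>(R ` S))" by (rule diff_card_le_card_Diff)
    with c u have "k \<le> card (C x - \<Union>(R ` S))" by simp
    then obtain B where B: "B \<subseteq> C x - \<Union>(R ` S)" "card B = k" "finite B"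
      by (meson obtain_subset_with_card_n)
    let ?R = "R(x := B)"
    have Rq: "?R q = R q" "R q \<inter> B = {}" if "q \<in> S" for q using that False B(1) by auto
    have "?R q \<subseteq> C q \<and> finite (?R q) \<and> card (?R q) = k" if "q \<in> insert x S" for q
      using that R Rq(1)[of q] B by (cases "q = x") auto
    moreover have "?R q \<inter> ?R r = {}" if qr: "q \<in> insert x S" "r \<in> insert x S" "q \<noteq> r" for q r
    proof -
      consider "q = x" "r \<in> S" | "r = x" "q \<in> S" | "q \<in> S" "r \<in> S" using qr by blast
      then show ?thesis
      proof cases
        case 1
        then show ?thesis using Rq[of r] by (simp add: Int_commute)
      next
        case 2
        then show ?thesis using Rq[of q] by simp
      next
        case 3
        then show ?thesis using Rq(1)[of q] Rq(1)[of r] disj qr(3) by metis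
      qed
    qed
    ultimately show ?thesis by (intro exI[of _ ?R] conjI ballI impI) blast+
  qed
qed auto

text \<open>Greedy choice: each chosen element discards at most \<open>Suc D\<close> elements,
  namely itself and its neighbours.\<close>

lemma independent_subset:
  assumes "finite G" "n * Suc D \<le> card G"
    and "\<And>l. l \<in> G \<Longrightarrow> finite (N l) \<and> card (N l) \<le> D"
    and "\<And>l r. l \<in> G \<Longrightarrow> r \<in> G \<Longrightarrow> l \<in> N r \<Longrightarrow> r \<in> N l"
  shows "\<exists>K\<subseteq>G. card K = n \<and> (\<forall>l\<in>K. \<forall>r\<in>K. l \<noteq> r \<longrightarrow> r \<notin> N l)"
  using assms
proof (induction n arbitrary: G)
  case 0
  then show ?case by (intro exI[of _ "{}"]) auto
next
  case (Suc n)
  then have "G \<noteq> {}" by auto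
  then obtain l where l: "l \<in> G" by blast
  let ?G = "G - insert l (N l)"
  have "finite (insert l (N l))" "card (insert l (N l)) \<le> Suc D"
    using Suc.prems(3)[OF l] by (auto simp: card_insert_if)
  then have "n * Suc D \<le> card ?G"
    using diff_card_le_card_Diff[of "insert l (N l)" G] Suc.prems(2) by simp
  moreover have "finite ?G" using Suc.prems(1) by simp
  moreover have "finite (N r) \<and> card (N r) \<le> D" if "r \<in> ?G" for r using Suc.prems(3) that by blast
  moreover have "r \<in> N s" if "r \<in> ?G" "s \<in> ?G" "s \<in> N r" for r s
    using Suc.prems(4)[of s r] that by blast
  ultimately obtain K where K: "K \<subseteq> ?G" "card K = n" "\<forall>l\<in>K. \<forall>r\<in>K. l \<noteq> r \<longrightarrow> r \<notin> N l"
    using Suc.IH[of ?G] by (metis (no_types, lifting))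
  have "finite K" using K(1) Suc.prems(1) finite_subset by blast
  moreover have "l \<notin> N r" if "r \<in> K" for r using Suc.prems(4)[of l r] K that l by blast
  moreover have "l \<notin> K" using K(1) by blast
  ultimately show ?case using K l
    by (intro exI[of _ "insert l K"]) auto
qed

text \<open>Double counting shows that an element of \<open>L\<close> lies in at most
  \<open>g * h\<close> of the sets \<open>H w\<close> on average, so at least half of
  \<open>L\<close> lies in at most \<open>2 * g * h\<close> of them. Among these, each element
  shares a set with at most \<open>2 * g * h * h\<close> elements, and a greedy independent set
  exists.\<close>

lemma sparse_transversal:
  assumes fin: "finite L" "finite J"
    and H: "\<And>w. w \<in> J \<Longrightarrow> H w \<subseteq> L \<and> card (H w) \<le> h"
    and J: "card J \<le> g * card L"
    and L: "2 * n * Suc (2 * g * h * h) \<le> card L"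
  shows "\<exists>K\<subseteq>L. card K = n \<and> (\<forall>w\<in>J. card (H w \<inter> K) \<le> 1)"
proof -
  define deg where "deg = (\<lambda>l. card {w\<in>J. l \<in> H w})"
  let ?G = "{l\<in>L. deg l \<le> 2 * g * h}" and ?B = "{l\<in>L. \<not> deg l \<le> 2 * g * h}"
  have fH: "finite (H w)" if "w \<in> J" for w using H[OF that] fin finite_subset by blast
  have "(\<Sum>l\<in>L. deg l) = (\<Sum>l\<in>L. \<Sum>w\<in>J. if l \<in> H w then 1 else 0)"
    using fin by (simp add: deg_def sum.If_cases Int_def)
  also have "\<dots> = (\<Sum>w\<in>J. \<Sum>l\<in>L. if l \<in> H w then 1 else 0)" by (rule sum.swap)
  also have "\<dots> = (\<Sum>w\<in>J. card (L \<inter> H w))" using fin by (simp add: sum.If_cases)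
  also have "\<dots> \<le> card J * h"
  proof -
    have "card (L \<inter> H w) \<le> h" if "w \<in> J" for w
      using H[OF that] card_mono[OF fH[OF that], of "L \<inter> H w"] by fastforce
    then show ?thesis using sum_bounded_above[of J "\<lambda>w. card (L \<inter> H w)" h] by simp
  qed
  also have "\<dots> \<le> g * card L * h" using J by simp
  finally have s: "(\<Sum>l\<in>L. deg l) \<le> g * h * card L" by (simp add: algebra_simps)
  have "Suc (2 * g * h) * card ?B \<le> (\<Sum>l\<in>?B. deg l)"
    using sum_bounded_below[of ?B "Suc (2 * g * h)" deg] by (simp add: mult.commute)
  also have "\<dots> \<le> (\<Sum>l\<in>L. deg l)" using fin by (intro sum_mono2) auto
  finally have b: "Suc (2 * g * h) * card ?B \<le> g * h * card L" using s by simp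
  have "2 * card ?B \<le> card L"
  proof (cases "g * h = 0")
    case True
    then show ?thesis using b by auto
  next
    case False
    have "(g * h) * (2 * card ?B) = (2 * g * h) * card ?B" by (simp only: mult_ac)
    also have "\<dots> \<le> Suc (2 * g * h) * card ?B" by (rule mult_le_mono1) simp
    also have "\<dots> \<le> (g * h) * card L" by (rule b)
    finally have "(g * h) * (2 * card ?B) \<le> (g * h) * card L" .
    then show ?thesis using False by (simp only: mult_le_cancel1)
  qed
  moreover have "card L = card ?G + card ?B"
    using fin by (subst card_Un_disjoint[symmetric]) (auto intro: arg_cong[where f = card])
  ultimately have G: "n * Suc (2 * g * h * h) \<le> card ?G" using L by simp
  \<comment> \<open>Two elements conflict if some \<open>H w\<close> contains both.\<close>
  define N where "N = (\<lambda>l. \<Union>(H ` {w\<in>J. l \<in> H w}))"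
  have "card (N l) \<le> 2 * g * h * h" if "l \<in> ?G" for l
  proof -
    have "card (N l) \<le> (\<Sum>w\<in>{w\<in>J. l \<in> H w}. card (H w))"
      unfolding N_def using fin by (intro card_UN_le) auto
    also have "\<dots> \<le> deg l * h"
      unfolding deg_def using sum_bounded_above[of "{w\<in>J. l \<in> H w}" "\<lambda>w. card (H w)" h] H by simp
    also have "\<dots> \<le> 2 * g * h * h" using that by simp
    finally show ?thesis .
  qed
  moreover have "finite (N l)" for l using fin fH by (auto simp: N_def)
  ultimately obtain K where K: "K \<subseteq> ?G" "card K = n" "\<forall>l\<in>K. \<forall>r\<in>K. l \<noteq> r \<longrightarrow> r \<notin> N l"
    using independent_subset[OF _ G, of N] fin by (auto simp: N_def)
  have "card (H w \<inter> K) \<le> 1" if "w \<in> J" for w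
  proof -
    have "l = r" if "l \<in> H w \<inter> K" "r \<in> H w \<inter> K" for l r
      using K(3) that \<open>w \<in> J\<close> unfolding N_def by blast
    then show ?thesis by (metis One_nat_def card_le_Suc0_iff_eq fH finite_Int that)
  qed
  then show ?thesis using K by blast
qed

lemma equipartition:
  assumes "finite A" "card A = k * t"
  shows "\<exists>i :: 'a \<Rightarrow> nat. (\<forall>a\<in>A. i a \<in> {1..t}) \<and> (\<forall>j\<in>{1..t}. card {a\<in>A. i a = j} = k)"
  using assms
proof (induction t arbitrary: A)
  case (Suc t)
  then have "k \<le> card A" by simp
  then obtain B where B: "B \<subseteq> A" "card B = k" "finite B"
    by (rule obtain_subset_with_card_n)
  then have "card (A - B) = k * t" using Suc.prems by (simp add: card_Diff_subset)
  with Suc.IH[of "A - B"] Suc.prems obtain i where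
    i: "\<forall>a\<in>A - B. i a \<in> {1..t}" "\<And>j. j \<in> {1..t} \<Longrightarrow> card {a\<in>A - B. i a = j} = k" by auto
  define i' where "i' = (\<lambda>a. if a \<in> B then Suc t else i a)"
  have "i a \<noteq> Suc t" if "a \<in> A - B" for a using bspec[OF i(1) that] by auto
  then have "{a\<in>A. i' a = Suc t} = B" using B(1) by (auto simp: i'_def)
  moreover have "{a\<in>A. i' a = j} = {a\<in>A - B. i a = j}" if "j \<in> {1..t}" for j
    using that B by (auto simp: i'_def)
  ultimately have "card {a\<in>A. i' a = j} = k" if "j \<in> {1..Suc t}" for j
    using that B(2) i(2) by (cases "j = Suc t") auto
  moreover have "i' a \<in> {1..Suc t}" if "a \<in> A" for a
    using bspec[OF i(1), of a] that by (auto simp: i'_def)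
  ultimately show ?case by blast
qed auto

text \<open>A vertex inherits its class from the seed reached by passing from child to parent;
  it does not matter which class vertices on parent cycles get.\<close>
lemma propagate_classes:
  fixes \<phi> :: "'a \<Rightarrow> nat"
  assumes "1 \<le> t" and \<phi>: "\<And>v. v \<in> F \<Longrightarrow> \<phi> v \<in> {1..t}"
    and disj: "\<And>u v w. u \<in> R v \<Longrightarrow> u \<in> R w \<Longrightarrow> v = w"
    and cons: "\<And>u w. u \<in> R w \<Longrightarrow> u \<in> F \<Longrightarrow> w \<in> F \<and> \<phi> u = \<phi> w"
  shows "\<exists>f. (\<forall>v. f v \<in> {1..t}) \<and> (\<forall>v\<in>F. f v = \<phi> v) \<and> (\<forall>w. \<forall>u\<in>R w. f u = f w)"
proof -
  \<comment> \<open>Only vertices outside \<open>F\<close> get a parent, so the way upwards ends at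
    the first seed and no vertex has two seeds.\<close>
  define par where "par = {(u, w). u \<in> R w \<and> u \<notin> F}"
  have sv: "single_valued par" using disj by (auto simp: par_def single_valued_def)
  have stop: "x = y" if "(x, y) \<in> par\<^sup>*" "x \<in> F" for x y
    using that by (cases rule: converse_rtranclE) (auto simp: par_def)
  have uniq: "x = y" if "(v, x) \<in> par\<^sup>*" "(v, y) \<in> par\<^sup>*" "x \<in> F" "y \<in> F" for v x y
    using single_valued_confluent[OF sv that(1,2)] stop that by blast
  define seed where "seed = (\<lambda>v x. x \<in> F \<and> (v, x) \<in> par\<^sup>*)"
  define f where "f = (\<lambda>v. if \<exists>x. seed v x then \<phi> (THE x. seed v x) else 1)"
  have f: "f v = \<phi> x" if "seed v x" for v x
  proof -
    have "(THE x. seed v x) = x" using that uniq by (intro the_equality) (auto simp: seed_def)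
    then show ?thesis using that by (auto simp: f_def)
  qed
  have "f v \<in> {1..t}" for v
  proof (cases "\<exists>x. seed v x")
    case True
    then obtain x where "seed v x" by blast
    then show ?thesis using f[of v x] \<phi>[of x] by (simp add: seed_def)
  next
    case False
    then have "f v = 1" unfolding f_def by (rule if_not_P)
    then show ?thesis using assms(1) by simp
  qed
  moreover have "f v = \<phi> v" if "v \<in> F" for v using that f[of v v] by (simp add: seed_def)
  moreover have "f u = f w" if u: "u \<in> R w" for u w
  proof (cases "u \<in> F")
    case True
    then show ?thesis using cons[OF u] \<open>\<And>v. v \<in> F \<Longrightarrow> f v = \<phi> v\<close> by simp
  next
    case False
    then have uw: "(u, w) \<in> par" using u by (simp add: par_def)
    have "seed u x \<longleftrightarrow> seed w x" for x
    proof
      assume "seed w x" then show "seed u x" using uw by (auto simp: seed_def)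
    next
      assume x: "seed u x"
      then have "(u, x) \<in> par\<^sup>*" "u \<noteq> x" using False by (auto simp: seed_def)
      then obtain w' where "(u, w') \<in> par" "(w', x) \<in> par\<^sup>*" by (metis converse_rtranclE)
      then have "(w, x) \<in> par\<^sup>*" using sv uw by (auto simp: single_valued_def)
      then show "seed w x" using x by (simp add: seed_def)
    qed
    then have "seed u = seed w" by blast
    then show ?thesis by (simp only: f_def)
  qed
  ultimately show ?thesis by blast
qed

text \<open>Fewer than \<open>k\<close> vertices are deleted, so one of the \<open>k\<close>
  neighbours of lower rank survives. The rank drops until an arc leads into \<open>A\<close>, which
  the deletion does not touch.\<close>

lemma robust_reach:
  fixes rank :: "'a \<Rightarrow> nat"
  assumes S: "finite S" "card S < k"
    and A: "A \<subseteq> W - S" "\<And>v. v \<in> A \<Longrightarrow> reach A E v a"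
    and zero: "\<And>w. w \<in> W \<Longrightarrow> rank w = 0 \<Longrightarrow> \<exists>v\<in>A. E w v"
    and pos: "\<And>w. w \<in> W \<Longrightarrow> rank w > 0 \<Longrightarrow> \<exists>R\<subseteq>W. card R = k \<and> (\<forall>u\<in>R. E w u \<and> rank u < rank w)"
    and w: "w \<in> W - S"
  shows "reach (W - S) E w a"
  using w
proof (induction "rank w" arbitrary: w rule: less_induct)
  case less
  show ?case
  proof (cases "rank w = 0")
    case True
    then obtain v where "v \<in> A" "E w v" using zero less.prems by blast
    then show ?thesis using A less.prems reach_mono[of A E v a "W - S"]
      by (intro reach_step[of E w v]) auto
  next
    case False
    then obtain R where R: "R \<subseteq> W" "card R = k" "\<forall>u\<in>R. E w u \<and> rank u < rank w"
      using pos less.prems by blast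
    have "\<not> R \<subseteq> S" using card_mono[OF S(1), of R] S(2) R(2) by auto
    then obtain u where "u \<in> R" "u \<notin> S" by blast
    then show ?thesis using R less by (intro reach_step[of E w u]) auto
  qed
qed

section \<open>Shortest linkages\<close>

definition shortest_linkage :: "('a \<Rightarrow> 'a \<Rightarrow> bool) \<Rightarrow> 'a set \<Rightarrow> 'a set \<Rightarrow> 'a list set \<Rightarrow> bool" where
  "shortest_linkage E X Y L \<longleftrightarrow> linkage E X Y L \<and>
     (\<forall>K. linkage E X Y K \<and> card K = card L \<longrightarrow> (\<Sum>p\<in>L. length p) \<le> (\<Sum>p\<in>K. length p))"

lemma shortest_linkage_exists:
  assumes "linkage E X Y L"
  shows "\<exists>K. shortest_linkage E X Y K \<and> card K = card L"
proof -
  let ?P = "\<lambda>K. linkage E X Y K \<and> card K = card L"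
  have "?P L" using assms by simp
  from ex_has_least_nat[of ?P, OF this, of "\<lambda>K. \<Sum>p\<in>K. length p"] show ?thesis
    unfolding shortest_linkage_def by metis
qed

lemma shortest_linkage_rev:
  assumes "shortest_linkage E X Y L"
  shows "shortest_linkage (\<lambda>x y. E y x) Y X (rev ` L)"
  unfolding shortest_linkage_def
proof (intro conjI allI impI)
  show "linkage (\<lambda>x y. E y x) Y X (rev ` L)" using assms linkage_rev by (auto simp: shortest_linkage_def)
  fix K assume K: "linkage (\<lambda>x y. E y x) Y X K \<and> card K = card (rev ` L)"
  then have "linkage E X Y (rev ` K)" "card (rev ` K) = card L"
    using linkage_rev[of "\<lambda>x y. E y x" Y X K] by (auto simp: card_image)
  then have "(\<Sum>p\<in>L. length p) \<le> (\<Sum>p\<in>rev ` K. length p)"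
    using assms by (auto simp: shortest_linkage_def)
  then show "(\<Sum>p\<in>rev ` L. length p) \<le> (\<Sum>p\<in>K. length p)"
    by (simp add: sum.reindex)
qed

text \<open>Exchanging one walk leaves the lengths of the others unchanged, so minimal total length
  compares the two walks directly. The new walk may share vertices with \<open>p\<close>.\<close>

lemma shortest_linkage_replace:
  assumes L: "shortest_linkage E X Y L" and p: "p \<in> L"
    and p': "walk E p'" "hd p' \<in> X" "last p' \<in> Y" "\<And>q. q \<in> L \<Longrightarrow> q \<noteq> p \<Longrightarrow> set p' \<inter> set q = {}"
  shows "length p \<le> length p'"
proof -
  let ?K = "insert p' (L - {p})"
  have lk: "linkage E X Y L" using L by (simp add: shortest_linkage_def)
  then have fin: "finite L" by (simp add: linkage_def)
  have "p' \<noteq> []" using p'(1) by (simp add: walk_def)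
  then have new: "p' \<notin> L - {p}" using p'(4) by (metis Diff_iff inf.idem insertI1 set_empty)
  have "linkage E X Y ?K"
    unfolding linkage_def
  proof (intro conjI ballI impI)
    fix q r assume qr: "q \<in> ?K" "r \<in> ?K" "q \<noteq> r"
    have d: "set x \<inter> set y = {}" if "x \<in> L" "y \<in> L" "x \<noteq> y" for x y
      using lk that by (auto simp: linkage_def)
    show "set q \<inter> set r = {}"
    proof (cases "q = p' \<or> r = p'")
      case True
      then show ?thesis using p'(4)[of q] p'(4)[of r] qr by (auto simp: Int_commute)
    next
      case False
      then show ?thesis using d[of q r] qr by blast
    qed
  next
    show "finite ?K" using fin by simp
    fix q assume "q \<in> ?K"
    then have "q = p' \<or> q \<in> L" by blast
    then show "walk E q" "hd q \<in> X" "last q \<in> Y" using p' lk by (auto simp: linkage_def)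
  qed
  moreover have "card ?K = Suc (card (L - {p}))" using new fin by (intro card_insert_disjoint) auto
  then have "card ?K = card L" using card.remove[OF fin p] by simp
  ultimately have "(\<Sum>q\<in>L. length q) \<le> (\<Sum>q\<in>?K. length q)" using L by (auto simp: shortest_linkage_def)
  also have "\<dots> = length p' + (\<Sum>q\<in>L - {p}. length q)" using new fin by simp
  finally show ?thesis by (simp add: sum.remove[OF fin p])
qed

lemma walk_drop: "walk E p \<Longrightarrow> j < length p \<Longrightarrow> walk E (drop j p)"
  by (metis append_take_drop_id Cons_nth_drop_Suc walk_suffix)

text \<open>A later visit to \<open>X\<close> would permit dropping everything before it. Hence each
  walk occupies just one vertex of \<open>X\<close>.\<close>

lemma shortest_linkage_head:
  assumes L: "shortest_linkage E X Y L" and p: "p \<in> L" and x: "x \<in> X" "x \<in> set p"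
  shows "x = hd p"
proof -
  have lk: "walk E p" "last p \<in> Y" "\<And>q. q \<in> L \<Longrightarrow> q \<noteq> p \<Longrightarrow> set p \<inter> set q = {}"
    using L p by (auto simp: shortest_linkage_def linkage_def)
  from x(2) obtain j where j: "j < length p" "p ! j = x" by (auto simp: in_set_conv_nth)
  have "length p \<le> length (drop j p)"
  proof (rule shortest_linkage_replace[OF L p])
    show "walk E (drop j p)" using walk_drop lk j by blast
    show "hd (drop j p) \<in> X" using j x by (simp add: hd_drop_conv_nth)
    show "last (drop j p) \<in> Y" using j lk by simp
    show "set (drop j p) \<inter> set q = {}" if "q \<in> L" "q \<noteq> p" for q
      using lk(3)[OF that] set_drop_subset[of j p] by blast
  qed
  then have "j = 0" using j by simp
  then show ?thesis using j by (simp add: hd_conv_nth[symmetric] flip: length_greater_0_conv)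
qed

lemma shortest_linkage_shortcut1:
  assumes L: "shortest_linkage E X Y L" and p: "p \<in> L"
    and u: "u \<in> X" "u \<notin> \<Union>(set ` L)" and j: "j < length p" "E u (p ! j)"
  shows "j \<le> 1"
proof -
  have lk: "walk E p" "last p \<in> Y" "\<And>q. q \<in> L \<Longrightarrow> q \<noteq> p \<Longrightarrow> set p \<inter> set q = {}"
    using L p by (auto simp: shortest_linkage_def linkage_def)
  have "length p \<le> length (u # drop j p)"
  proof (rule shortest_linkage_replace[OF L p])
    show "walk E (u # drop j p)" using walk_drop[OF lk(1) j(1)] j
      by (auto simp: walk_def successively_Cons hd_drop_conv_nth)
    show "last (u # drop j p) \<in> Y" using j lk by simp
    show "set (u # drop j p) \<inter> set q = {}" if "q \<in> L" "q \<noteq> p" for q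
      using lk(3)[OF that] set_drop_subset[of j p] u that by auto
  qed (use u in simp)
  then show ?thesis using j by simp
qed

text \<open>The detour over \<open>w\<close> costs two new vertices, which leaves the three
  positions 0, 1 and 2.\<close>

lemma shortest_linkage_shortcut2:
  assumes L: "shortest_linkage E X Y L" and p: "p \<in> L"
    and u: "u \<in> X" "u \<notin> \<Union>(set ` L)" and w: "w \<notin> \<Union>(set ` L)" "E u w"
    and j: "j < length p" "E w (p ! j)"
  shows "j \<le> 2"
proof -
  have lk: "walk E p" "last p \<in> Y" "\<And>q. q \<in> L \<Longrightarrow> q \<noteq> p \<Longrightarrow> set p \<inter> set q = {}"
    using L p by (auto simp: shortest_linkage_def linkage_def)
  have "length p \<le> length (u # w # drop j p)"
  proof (rule shortest_linkage_replace[OF L p])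
    show "walk E (u # w # drop j p)" using walk_drop[OF lk(1) j(1)] j w
      by (auto simp: walk_def successively_Cons hd_drop_conv_nth)
    show "last (u # w # drop j p) \<in> Y" using j lk by simp
    show "set (u # w # drop j p) \<inter> set q = {}" if "q \<in> L" "q \<noteq> p" for q
      using lk(3)[OF that] set_drop_subset[of j p] u w that by auto
  qed (use u in simp)
  then show ?thesis using j by simp
qed

section \<open>The partition of a linked tournament\<close>

text \<open>The flag lets one statement serve a tournament and its converse, so out-chains and
  in-chains are treated together.\<close>

definition dir :: "('a \<Rightarrow> 'a \<Rightarrow> bool) \<Rightarrow> bool \<Rightarrow> 'a \<Rightarrow> 'a \<Rightarrow> bool" where
  "dir E b = (if b then E else (\<lambda>x y. E y x))"

lemma tournament_dir: "tournament V E \<Longrightarrow> tournament V (dir E b)"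
  by (auto simp: dir_def tournament_converse)

lemma set_walk_induced:
  assumes "walk (induced_arcs B E) p" "hd p \<in> B"
  shows "set p \<subseteq> B"
  using assms
proof (induction p)
  case (Cons x p)
  then show ?case by (cases p) (auto simp: walk_def induced_arcs_def)
qed simp

text \<open>Each set that meets \<open>S\<close> picks a point there; disjointness makes the choice
  injective.\<close>

lemma card_meeting_le:
  assumes fin: "finite L" "finite S"
    and disj: "\<And>p r. p \<in> L \<Longrightarrow> r \<in> L \<Longrightarrow> p \<noteq> r \<Longrightarrow> T p \<inter> T r = {}"
  shows "card {p\<in>L. T p \<inter> S \<noteq> {}} \<le> card S"
proof -
  let ?K = "{p\<in>L. T p \<inter> S \<noteq> {}}"
  define x where "x = (\<lambda>p. SOME v. v \<in> T p \<inter> S)"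
  have x: "x p \<in> T p \<inter> S" if "p \<in> ?K" for p
    unfolding x_def by (rule someI_ex) (use that in blast)
  have "inj_on x ?K"
  proof (rule inj_onI)
    fix p r assume pr: "p \<in> ?K" "r \<in> ?K" "x p = x r"
    then have "x p \<in> T p \<inter> T r" using x[of p] x[of r] by simp
    then show "p = r" using disj[of p r] pr by blast
  qed
  moreover have "x ` ?K \<subseteq> S" using x by blast
  ultimately show ?thesis using fin by (intro card_inj_on_le)
qed

locale linked_tournament =
  fixes V :: "'a set" and E :: "'a \<Rightarrow> 'a \<Rightarrow> bool" and k t c g M m n q :: nat
    and Z :: "bool \<Rightarrow> 'a set" and d :: "bool \<Rightarrow> nat"
    and A :: "'a \<Rightarrow> 'a set" and tip :: "'a \<Rightarrow> 'a" and L :: "'a list set"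
    and ZZ C X V'
  defines "ZZ \<equiv> Z True \<union> Z False"
    and "C \<equiv> \<Union>(A ` ZZ)"
    and "X \<equiv> \<lambda>b. tip ` Z b"
    and "V' \<equiv> V - (C - (X True \<union> X False))"
  assumes tour: "tournament V E"
    and k: "1 \<le> k" and t: "1 \<le> t"
    and m: "m = M + k * t" and q: "q = 2 * m * (c + 2)"
    and pow: "16 * k * m \<le> 2 ^ c" and n: "16 * k * q \<le> n"
    and g: "q + 4 * M \<le> g * M"
    and M: "2 * (k * t) * Suc (2 * g * (2 * k + 1) * (2 * k + 1)) \<le> M"
    and Z: "Z b \<subseteq> V" "card (Z b) = m" and Z_disj: "Z True \<inter> Z False = {}"
    and A: "z \<in> ZZ \<Longrightarrow> A z \<subseteq> V \<and> card (A z) \<le> c + 2 \<and> z \<in> A z \<and> tip z \<in> A z \<and> tip z \<noteq> z"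
    and A_disj: "y \<in> ZZ \<Longrightarrow> z \<in> ZZ \<Longrightarrow> y \<noteq> z \<Longrightarrow> A y \<inter> A z = {}"
    and A_reach: "z \<in> Z b \<Longrightarrow> v \<in> A z \<Longrightarrow> reach (A z) (dir E b) v (tip z)"
    and A_rest: "z \<in> Z b \<Longrightarrow> card {w\<in>V - C. \<forall>v\<in>A z. \<not> dir E b w v} * 2 ^ c \<le> d b"
    and deg_n: "v \<in> V \<Longrightarrow> n \<le> card {w\<in>V. dir E b v w}"
    and deg_d: "v \<in> V - ZZ \<Longrightarrow> d b \<le> card {w\<in>V. dir E b v w}"
    and d: "n \<le> d b"
    and L: "shortest_linkage (induced_arcs V' E) (X True) (X False) L" and card_L: "card L = M"
begin

definition orient :: "bool \<Rightarrow> 'a list \<Rightarrow> 'a list" where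
  "orient b p = (if b then p else rev p)"

definition covered :: "'a set" where "covered = \<Union>(set ` L)"

definition U :: "bool \<Rightarrow> 'a set" where "U b = X b - covered"

text \<open>The exceptional vertices, whose reserved neighbours may have to lie on the walks of \<open>L\<close>.\<close>
definition Sp :: "'a set" where
  "Sp = (C - (U True \<union> U False)) \<union> (\<Union>p\<in>L. set (take 2 p) \<union> set (take 2 (rev p)))"

text \<open>All of \<open>C\<close> counts as bad because the leftovers of the chains are controlled
  only outside \<open>C\<close>.\<close>

definition Bad :: "bool \<Rightarrow> 'a set" where
  "Bad b = C \<union> {w\<in>V. \<exists>z\<in>Z b. \<forall>v\<in>A z. \<not> dir E b w v}"

text \<open>A bad vertex outside \<open>Q b\<close> sends arcs to all of \<open>U b\<close>, so it needs no reserved neighbours.\<close>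
definition Q :: "bool \<Rightarrow> 'a set" where
  "Q b = {w\<in>Bad b. w \<in> Sp \<or> w \<in> U b \<or> (\<exists>u\<in>U b. dir E b u w)}"

section \<open>Chains, tips and walks: basic facts\<close>

lemma finV: "finite V" using tour by (simp add: tournament_def)

lemma Z_ZZ: "z \<in> Z b \<Longrightarrow> z \<in> ZZ" by (cases b) (auto simp: ZZ_def)

lemma finZ: "finite (Z b)" using Z(1) finV finite_subset by blast

lemma finZZ: "finite ZZ" using finZ by (simp add: ZZ_def)

lemma card_ZZ: "card ZZ = 2 * m"
  using card_Un_disjoint[OF finZ finZ Z_disj] Z(2) by (simp add: ZZ_def)

lemma C_V: "C \<subseteq> V" using A by (auto simp: C_def)

lemma finC: "finite C" using C_V finV finite_subset by blast

lemma ZZ_C: "ZZ \<subseteq> C" using A by (auto simp: C_def)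

lemma X_C: "X b \<subseteq> C"
proof
  fix x assume "x \<in> X b"
  then obtain z where "z \<in> Z b" "x = tip z" by (auto simp: X_def)
  then show "x \<in> C" using A[OF Z_ZZ, of z b] Z_ZZ[of z b] by (auto simp: C_def)
qed

lemma card_C: "card C \<le> q"
proof -
  have "card C \<le> (\<Sum>z\<in>ZZ. card (A z))" unfolding C_def by (rule card_UN_le[OF finZZ])
  also have "\<dots> \<le> card ZZ * (c + 2)" using sum_bounded_above[of ZZ "\<lambda>z. card (A z)" "c + 2"] A by simp
  finally show ?thesis by (simp add: card_ZZ q)
qed

lemma tip_eq: "tip z = v \<Longrightarrow> y \<in> ZZ \<Longrightarrow> z \<in> ZZ \<Longrightarrow> v \<in> A y \<Longrightarrow> y = z"
  using A_disj[of y z] A[of z] by blast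

lemma tip_notin_ZZ: "z \<in> ZZ \<Longrightarrow> tip z \<notin> ZZ"
  using tip_eq[of z "tip z" "tip z"] A[of z] A[of "tip z"] by auto

lemma inj_tip: "inj_on tip ZZ"
  by (rule inj_onI) (metis A tip_eq)

lemma X_disj: "X True \<inter> X False = {}"
proof -
  have "tip y \<noteq> tip z" if "y \<in> Z True" "z \<in> Z False" for y z
    using inj_onD[OF inj_tip, of y z] Z_ZZ[OF that(1)] Z_ZZ[OF that(2)] Z_disj that by blast
  then show ?thesis by (auto simp: X_def)
qed

lemma card_X: "card (X b) = m"
  using card_image[OF inj_on_subset[OF inj_tip, of "Z b"]] Z_ZZ Z(2) by (auto simp: X_def)

lemma X_V': "X b \<subseteq> V'" using X_C[of b] C_V by (cases b) (auto simp: V'_def)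

lemma V'_V: "V' \<subseteq> V" by (auto simp: V'_def)

lemma V'_C: "V' \<inter> C \<subseteq> X True \<union> X False" by (auto simp: V'_def)

lemma linkage_L: "linkage (induced_arcs V' E) (X True) (X False) L"
  using L by (simp add: shortest_linkage_def)

lemma finL: "finite L" using linkage_L by (simp add: linkage_def)

lemma walk_L:
  assumes "p \<in> L"
  shows "walk (induced_arcs V' E) p" "hd p \<in> X True" "last p \<in> X False" "p \<noteq> []"
  using linkage_L assms by (auto simp: linkage_def walk_def)

lemma L_disj: "p \<in> L \<Longrightarrow> r \<in> L \<Longrightarrow> p \<noteq> r \<Longrightarrow> set p \<inter> set r = {}"
  using linkage_L by (auto simp: linkage_def)

lemma L_V': "p \<in> L \<Longrightarrow> set p \<subseteq> V'"
  using set_walk_induced[OF walk_L(1)] walk_L(2) X_V' by blast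

lemma set_orient [simp]: "set (orient b p) = set p" by (simp add: orient_def)

lemma shortest_orient:
  "shortest_linkage (induced_arcs V' (dir E b)) (X b) (X (\<not> b)) (orient b ` L)"
proof (cases b)
  case True
  then show ?thesis using L by (simp add: orient_def[abs_def] dir_def)
next
  case False
  have "induced_arcs V' (\<lambda>x y. E y x) = (\<lambda>x y. induced_arcs V' E y x)"
    by (auto simp: induced_arcs_def fun_eq_iff)
  then show ?thesis using shortest_linkage_rev[OF L] False by (simp add: orient_def[abs_def] dir_def)
qed

lemma covered_orient: "\<Union>(set ` orient b ` L) = covered"
  by (auto simp: covered_def)

lemma head_orient:
  assumes "p \<in> L" "x \<in> X b" "x \<in> set p"
  shows "x = hd (orient b p)"
  using shortest_linkage_head[OF shortest_orient, of "orient b p" b x] assms by simp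

lemma head_in_X:
  assumes "p \<in> L"
  shows "hd (orient b p) \<in> X b \<and> hd (orient b p) \<in> set p"
  using walk_L[OF assms] by (auto simp: orient_def hd_rev)

text \<open>By minimality each walk contains exactly one tip of \<open>X b\<close>, its first vertex
  in that orientation, so \<open>M\<close> of the \<open>M + k * t\<close> tips are covered.\<close>

lemma card_U: "card (U b) = k * t"
proof -
  have "X b \<inter> covered = (\<lambda>p. hd (orient b p)) ` L"
  proof
    show "X b \<inter> covered \<subseteq> (\<lambda>p. hd (orient b p)) ` L"
      unfolding covered_def using head_orient by blast
    show "(\<lambda>p. hd (orient b p)) ` L \<subseteq> X b \<inter> covered"
      unfolding covered_def using head_in_X by blast
  qed
  moreover have "inj_on (\<lambda>p. hd (orient b p)) L"
  proof (rule inj_onI)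
    fix p r assume pr: "p \<in> L" "r \<in> L" "hd (orient b p) = hd (orient b r)"
    then have "hd (orient b p) \<in> set p \<inter> set r" using head_in_X[OF pr(1), of b] head_in_X[OF pr(2), of b] by simp
    then show "p = r" using L_disj[OF pr(1,2)] by blast
  qed
  ultimately have "card (X b \<inter> covered) = M" by (simp add: card_image card_L)
  moreover have "finite (X b)" using finZ by (simp add: X_def)
  ultimately show ?thesis using card_X[of b] m by (simp add: U_def card_Diff_subset_Int)
qed

lemma U_X: "U b \<subseteq> X b" by (auto simp: U_def)

lemma U_V: "U b \<subseteq> V" using U_X[of b] X_C[of b] C_V by blast

lemma finU: "finite (U b)" using U_V finV finite_subset by blast

lemma U_disj: "U True \<inter> U False = {}" using X_disj U_X by blast

lemma ends_covered: "(\<Union>p\<in>L. set (take 2 p) \<union> set (take 2 (rev p))) \<subseteq> covered"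
  unfolding covered_def using set_take_subset[of 2] set_rev by fast

lemma take_orient: "p \<in> L \<Longrightarrow> set (take 2 (orient b p)) \<subseteq> Sp"
  by (cases b) (auto simp: Sp_def orient_def)

lemma U_Sp: "u \<in> U b \<Longrightarrow> u \<notin> Sp"
  using ends_covered by (cases b) (auto simp: Sp_def U_def)

lemma U_Q: "U b \<subseteq> Q b"
  using U_X[of b] X_C[of b] by (auto simp: Q_def Bad_def)

lemma U_ZZ: "U b \<inter> ZZ = {}"
  using U_X[of b] tip_notin_ZZ Z_ZZ by (fastforce simp: X_def)

lemma Bad_V: "Bad b \<subseteq> V" using C_V by (auto simp: Bad_def)

lemma Q_V: "Q b \<subseteq> V" using Bad_V by (auto simp: Q_def)

lemma dir_induced: "u \<in> V' \<Longrightarrow> v \<in> V' \<Longrightarrow> dir E b u v \<Longrightarrow> induced_arcs V' (dir E b) u v"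
  by (simp add: induced_arcs_def)

text \<open>The key point: an unused tip \<open>u\<close> with \<open>u \<rightarrow> w\<close> would allow a shorter linkage starting
  \<open>u, w, \<dots>\<close> if \<open>w\<close> had an arc to a late vertex of a walk.\<close>
lemma ordinary:
  assumes w: "w \<in> Q b" "w \<notin> Sp"
  shows "w \<notin> covered" and "\<And>p. p \<in> L \<Longrightarrow> card ({v\<in>V. dir E b w v} \<inter> set p) \<le> 3"
proof -
  have "w \<in> V" using w Q_V by blast
  then have wV': "w \<in> V'" using w(2) U_X by (auto simp: Sp_def V'_def)
  have UV': "u \<in> V'" if "u \<in> U b" for u using that U_X X_V' by blast
  have unc: "u \<in> X b \<and> u \<notin> \<Union>(set ` orient b ` L)" if "u \<in> U b" for u
    using that by (simp only: covered_orient) (simp add: U_def)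
  have cases: "w \<in> U b \<or> (\<exists>u\<in>U b. dir E b u w)" using w by (auto simp: Q_def)
  show nc: "w \<notin> covered"
  proof
    assume wc: "w \<in> covered"
    then have "w \<notin> U b" by (simp add: U_def)
    then obtain u where u: "u \<in> U b" "dir E b u w" using cases by blast
    obtain p where p: "p \<in> L" "w \<in> set p" using wc by (auto simp: covered_def)
    then have "w \<in> set (orient b p)" by simp
    then obtain j where j: "j < length (orient b p)" "orient b p ! j = w" by (metis in_set_conv_nth)
    \<comment> \<open>The shortcut from \<open>u\<close> to \<open>w\<close> leaves only the first
      two positions, and those belong to \<open>Sp\<close>; this is why \<open>Sp\<close> takes two
      vertices from each end.\<close>
    have "j \<le> 1"
      by (rule shortest_linkage_shortcut1[OF shortest_orient imageI[OF p(1)] _ _ j(1)])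
        (use unc[OF u(1)] j(2) dir_induced[OF UV'[OF u(1)] wV' u(2)] in auto)
    then have "orient b p ! j \<in> set (take 2 (orient b p))"
      using j(1) by (auto simp: in_set_conv_nth intro!: exI[of _ j])
    then show False using j(2) take_orient[OF p(1), of b] w(2) by blast
  qed
  have nc': "w \<notin> \<Union>(set ` orient b ` L)" unfolding covered_orient by (rule nc)
  fix p assume p: "p \<in> L"
  have "{v\<in>V. dir E b w v} \<inter> set p \<subseteq> set (take 3 (orient b p))"
  proof
    fix v assume v: "v \<in> {v\<in>V. dir E b w v} \<inter> set p"
    then have "v \<in> set (orient b p)" by simp
    then obtain j where j: "j < length (orient b p)" "orient b p ! j = v" by (metis in_set_conv_nth)
    have "v \<in> V'" using v L_V'[OF p] by blast
    then have arc: "induced_arcs V' (dir E b) w (orient b p ! j)"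
      using dir_induced[OF wV'] v j(2) by blast
    have "j \<le> 2"
    proof (cases "w \<in> U b")
      case True
      have "j \<le> 1"
        by (rule shortest_linkage_shortcut1[OF shortest_orient imageI[OF p] _ _ j(1) arc])
          (use unc[OF True] in blast)+
      then show ?thesis by simp
    next
      case False
      then obtain u where u: "u \<in> U b" "dir E b u w" using cases by blast
      show ?thesis
        by (rule shortest_linkage_shortcut2[OF shortest_orient imageI[OF p] _ _ _ _ j(1) arc])
          (use unc[OF u(1)] nc' dir_induced[OF UV'[OF u(1)] wV' u(2)] in blast)+
    qed
    then show "v \<in> set (take 3 (orient b p))"
      using j by (auto simp: in_set_conv_nth intro!: exI[of _ j])
  qed
  then have "card ({v\<in>V. dir E b w v} \<inter> set p) \<le> card (set (take 3 (orient b p)))"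
    by (intro card_mono) auto
  also have "\<dots> \<le> length (take 3 (orient b p))" by (rule card_length)
  finally show "card ({v\<in>V. dir E b w v} \<inter> set p) \<le> 3" by simp
qed

section \<open>Sizes of the exceptional and the bad sets\<close>

lemma four_m: "4 * m \<le> q" by (simp add: q)

lemma four_M: "4 * M \<le> q" using four_m m by linarith

lemma card_Sp: "card Sp \<le> q + 4 * M" and finSp: "finite Sp"
proof -
  let ?e = "\<Union>p\<in>L. set (take 2 p) \<union> set (take 2 (rev p))"
  have "card (set (take 2 p) \<union> set (take 2 (rev p))) \<le> 4" for p :: "'a list"
    using card_Un_le[of "set (take 2 p)" "set (take 2 (rev p))"]
      card_length[of "take 2 p"] card_length[of "take 2 (rev p)"] by simp
  then have "(\<Sum>p\<in>L. card (set (take 2 p) \<union> set (take 2 (rev p)))) \<le> card L * 4"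
    using sum_bounded_above[of L "\<lambda>p. card (set (take 2 p) \<union> set (take 2 (rev p)))" 4] by simp
  then have "card ?e \<le> 4 * M" using card_UN_le[OF finL, of "\<lambda>p. set (take 2 p) \<union> set (take 2 (rev p))"] card_L by simp
  moreover have "card (C - (U True \<union> U False)) \<le> q"
    using card_mono[OF finC, of "C - (U True \<union> U False)"] card_C by force
  ultimately show "card Sp \<le> q + 4 * M"
    unfolding Sp_def by (meson card_Un_le add_mono order_trans)
  show "finite Sp" using finC finL by (auto simp: Sp_def)
qed

text \<open>Each of the \<open>m\<close> leftovers has at most \<open>d b / 2 ^ c\<close> vertices
  and \<open>2 ^ c\<close> is at least \<open>16 * k * m\<close>, so together they have at most
  \<open>d b / (16 * k)\<close>. The factor \<open>16 * k\<close> is kept on the left to avoid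
  division.\<close>

lemma card_Bad: "16 * k * card (Bad b) \<le> 16 * k * q + d b"
proof -
  let ?r = "\<lambda>z. {w\<in>V - C. \<forall>v\<in>A z. \<not> dir E b w v}"
  have "Bad b \<subseteq> C \<union> (\<Union>z\<in>Z b. ?r z)" by (auto simp: Bad_def)
  moreover have "finite (C \<union> (\<Union>z\<in>Z b. ?r z))" using finC finV finZ by auto
  ultimately have "card (Bad b) \<le> card (C \<union> (\<Union>z\<in>Z b. ?r z))" by (rule card_mono[rotated])
  also have "\<dots> \<le> card C + card (\<Union>z\<in>Z b. ?r z)" by (rule card_Un_le)
  also have "card (\<Union>z\<in>Z b. ?r z) \<le> (\<Sum>z\<in>Z b. card (?r z))" by (rule card_UN_le[OF finZ])
  finally have 1: "card (Bad b) \<le> q + (\<Sum>z\<in>Z b. card (?r z))" using card_C by simp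
  have "(\<Sum>z\<in>Z b. card (?r z)) * 2 ^ c = (\<Sum>z\<in>Z b. card (?r z) * 2 ^ c)" by (rule sum_distrib_right)
  also have "\<dots> \<le> m * d b" using sum_bounded_above[of "Z b" "\<lambda>z. card (?r z) * 2 ^ c" "d b"] A_rest Z(2) by simp
  finally have "16 * k * ((\<Sum>z\<in>Z b. card (?r z)) * 2 ^ c) \<le> 16 * k * (m * d b)" by (rule mult_le_mono2)
  also have "\<dots> \<le> 2 ^ c * d b" using mult_le_mono1[OF pow, of "d b"] by (simp add: mult.assoc)
  finally have "2 ^ c * (16 * k * (\<Sum>z\<in>Z b. card (?r z))) \<le> 2 ^ c * d b" by (simp add: mult_ac)
  then have 2: "16 * k * (\<Sum>z\<in>Z b. card (?r z)) \<le> d b" by simp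
  have "16 * k * card (Bad b) \<le> 16 * k * (q + (\<Sum>z\<in>Z b. card (?r z)))" using 1 by (rule mult_le_mono2)
  then show ?thesis using 2 by (simp add: distrib_left)
qed

section \<open>Requests for reserved neighbours, one per vertex and orientation\<close>

definition Req :: "('a \<times> bool) set" where "Req = {(w, b). w \<in> Q b}"

text \<open>The degree that is guaranteed in the orientation \<open>b\<close>; requests are served
  in this order.\<close>

definition level :: "'a \<times> bool \<Rightarrow> nat" where
  "level = (\<lambda>(w, b). if w \<in> ZZ then n else d b)"

text \<open>Avoiding \<open>C\<close> and \<open>Sp\<close> means that a reserved vertex is neither
  a tip nor exceptional, so no class is forced on it through reserved neighbours of its own.
  Avoiding \<open>Bad b\<close> makes the rank drop to zero, but starting vertices may have too
  small a degree for that. Avoiding \<open>covered\<close> is affordable for ordinary vertices,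
  which have at most three neighbours on each walk.\<close>

definition avoid :: "'a \<times> bool \<Rightarrow> 'a set" where
  "avoid = (\<lambda>(w, b). C \<union> Sp \<union> (if w \<in> ZZ then {} else Bad b) \<union> (if w \<in> Sp then {} else covered))"

definition cand :: "'a \<times> bool \<Rightarrow> 'a set" where
  "cand = (\<lambda>(w, b). {v\<in>V. dir E b w v} - avoid (w, b))"

lemma finReq: "finite Req"
proof -
  have "Req \<subseteq> V \<times> UNIV" using Q_V by (auto simp: Req_def)
  then show ?thesis using finV finite_subset by (metis finite_SigmaI finite_UNIV)
qed

lemma level_n: "n \<le> level r" using d by (cases r) (auto simp: level_def)

text \<open>The avoided neighbours number at most \<open>q\<close> for \<open>C\<close>,
  \<open>2 * q\<close> for \<open>Sp\<close>, \<open>q\<close> plus a sixteenth of the level for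
  \<open>Bad b\<close>, and \<open>q\<close> for \<open>covered\<close>; the five copies of
  \<open>q\<close> give 80 after scaling by 16.\<close>

lemma card_cand:
  assumes "r \<in> Req"
  shows "15 * level r \<le> 16 * card (cand r) + 80 * q"
proof -
  obtain w b where r: "r = (w, b)" by (cases r)
  have w: "w \<in> Q b" "w \<in> V" using assms Q_V r by (auto simp: Req_def)
  let ?N = "{v\<in>V. dir E b w v}"
  let ?B = "if w \<in> ZZ then {} else Bad b" and ?P = "if w \<in> Sp then {} else covered"
  have finN: "finite ?N" using finV by simp
  have N: "level r \<le> card ?N"
    using deg_n[OF w(2), of b] deg_d[of w b] w(2) by (auto simp: level_def r)
  have B: "16 * card ?B \<le> 16 * q + level r"
  proof (cases "w \<in> ZZ")
    case False
    have "16 * (k * card (Bad b)) \<le> 16 * (k * q) + d b" using card_Bad[of b] by (simp add: mult.assoc)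
    moreover have "d b \<le> k * d b" using k by simp
    ultimately have "k * (16 * card (Bad b)) \<le> k * (16 * q + d b)"
      unfolding distrib_left mult.left_commute[of k 16] by linarith
    then show ?thesis using k False by (simp add: level_def r)
  qed simp
  have P: "card (?N \<inter> ?P) \<le> q"
  proof (cases "w \<in> Sp")
    case False
    have "?N \<inter> covered = (\<Union>p\<in>L. ?N \<inter> set p)" by (auto simp: covered_def)
    then have "card (?N \<inter> covered) \<le> (\<Sum>p\<in>L. card (?N \<inter> set p))"
      by (simp only: card_UN_le[OF finL])
    also have "\<dots> \<le> 3 * M"
      using sum_bounded_above[of L "\<lambda>p. card (?N \<inter> set p)" 3] ordinary(2)[OF w(1) False] card_L by simp
    finally show ?thesis using four_M False by simp
  qed simp
  have "?N \<subseteq> cand r \<union> (C \<union> (Sp \<union> (?B \<union> (?N \<inter> ?P))))"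
    by (auto simp: cand_def avoid_def r)
  moreover have "finite (cand r \<union> (C \<union> (Sp \<union> (?B \<union> (?N \<inter> ?P)))))"
    using finN finC finSp finite_subset[OF Bad_V finV] by (auto simp: cand_def r)
  ultimately have "card ?N \<le> card (cand r \<union> (C \<union> (Sp \<union> (?B \<union> (?N \<inter> ?P)))))" by (rule card_mono[rotated])
  also have "\<dots> \<le> card (cand r) + (card C + (card Sp + (card ?B + card (?N \<inter> ?P))))"
    by (intro order_trans[OF card_Un_le] add_mono order_refl)
  finally show ?thesis using N B P card_C card_Sp four_M by linarith
qed

text \<open>An orientation contributes its bad vertices only if \<open>d b \<le> x\<close>, so their
  number can be measured against \<open>x\<close>. Starting vertices contribute at most
  \<open>4 * m \<le> q\<close> requests.\<close>

lemma card_level: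
  assumes "n \<le> x"
  shows "16 * (k * card {r\<in>Req. level r \<le> x}) \<le> 48 * (k * q) + 2 * x"
proof -
  let ?B = "\<lambda>b. if d b \<le> x then Bad b \<times> {b} else {}"
  have B: "16 * (k * card (?B b)) \<le> 16 * (k * q) + x" for b
    using card_Bad[of b] by (simp add: mult.assoc card_cartesian_product)
  have fB: "finite (?B b)" for b using finite_subset[OF Bad_V finV, of b] by simp
  have "{r\<in>Req. level r \<le> x} \<subseteq> (ZZ \<times> UNIV) \<union> (?B True \<union> ?B False)"
  proof
    fix r assume r: "r \<in> {r\<in>Req. level r \<le> x}"
    obtain w b where wb: "r = (w, b)" by (cases r)
    show "r \<in> (ZZ \<times> UNIV) \<union> (?B True \<union> ?B False)"
      using r unfolding wb by (cases b) (auto simp: Req_def Q_def level_def split: if_splits)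
  qed
  then have "card {r\<in>Req. level r \<le> x} \<le> card ((ZZ \<times> (UNIV :: bool set)) \<union> (?B True \<union> ?B False))"
    using finZZ fB by (intro card_mono) auto
  also have "\<dots> \<le> card (ZZ \<times> (UNIV :: bool set)) + (card (?B True) + card (?B False))"
    by (intro order_trans[OF card_Un_le] add_mono order_refl)
  also have "card (ZZ \<times> (UNIV :: bool set)) = 4 * m" using card_ZZ by (simp add: card_cartesian_product)
  finally have "card {r\<in>Req. level r \<le> x} \<le> q + (card (?B True) + card (?B False))" using four_m by linarith
  then have "k * card {r\<in>Req. level r \<le> x} \<le> k * (q + (card (?B True) + card (?B False)))" by (rule mult_le_mono2)
  then have "k * card {r\<in>Req. level r \<le> x} \<le> k * q + k * card (?B True) + k * card (?B False)"
    by (simp only: distrib_left add.assoc)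
  then show ?thesis using B[of True] B[of False] by linarith
qed

lemma representatives:
  obtains R where "\<forall>r\<in>Req. R r \<subseteq> cand r \<and> finite (R r) \<and> card (R r) = k"
    and "\<forall>r\<in>Req. \<forall>s\<in>Req. r \<noteq> s \<longrightarrow> R r \<inter> R s = {}"
proof -
  have "k * card {s\<in>Req. level s \<le> level r} \<le> card (cand r)" if "r \<in> Req" for r
  proof -
    \<comment> \<open>Since the level is at least \<open>16 * k * q\<close>, demand is at most
      \<open>5 / 16\<close> and supply at least \<open>10 / 16\<close> of it.\<close>
    have "q \<le> k * q" using k by simp
    moreover have "16 * (k * q) \<le> level r" using n level_n[of r] by (simp add: mult.assoc)
    ultimately show ?thesis using card_cand[OF that] card_level[OF level_n, of r] by linarith
  qed
  from disjoint_representatives[OF finReq this] show ?thesis using that by blast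
qed

section \<open>Structures: walks with the chains attached at their ends\<close>

definition struct :: "'a list \<Rightarrow> 'a set" where
  "struct p = set p \<union> \<Union>(A ` {z\<in>ZZ. tip z \<in> set p})"

lemma struct_V: "p \<in> L \<Longrightarrow> struct p \<subseteq> V"
  using L_V' V'_V A unfolding struct_def by blast

lemma struct_sub: "p \<in> L \<Longrightarrow> struct p \<subseteq> covered \<union> C"
  unfolding struct_def covered_def C_def by blast

lemma tip_if_C: "p \<in> L \<Longrightarrow> v \<in> set p \<Longrightarrow> z \<in> ZZ \<Longrightarrow> v \<in> A z \<Longrightarrow> v = tip z"
proof -
  assume a: "p \<in> L" "v \<in> set p" "z \<in> ZZ" "v \<in> A z"
  then have "v \<in> V' \<inter> C" using L_V' by (auto simp: C_def)
  then have "v \<in> tip ` ZZ" using V'_C Z_ZZ by (auto simp: X_def ZZ_def)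
  then obtain y where "y \<in> ZZ" "v = tip y" by blast
  then show "v = tip z" using tip_eq[of y v z] a by simp
qed

text \<open>Walks stay in \<open>V'\<close> and meet chains in tips only. So no walk enters a chain
  attached to another walk, and a chain is attached to at most one walk.\<close>

lemma struct_disj:
  assumes p: "p \<in> L" and r: "r \<in> L" and "p \<noteq> r"
  shows "struct p \<inter> struct r = {}"
proof -
  have d: "set p \<inter> set r = {}" using L_disj assms by blast
  have False if v: "v \<in> struct p" "v \<in> struct r" for v
  proof -
    consider "v \<in> set p" "v \<in> set r"
      | z where "z \<in> ZZ" "tip z \<in> set p" "v \<in> A z" "v \<in> set r"
      | z where "z \<in> ZZ" "tip z \<in> set r" "v \<in> A z" "v \<in> set p"
      | y z where "y \<in> ZZ" "z \<in> ZZ" "tip y \<in> set p" "tip z \<in> set r" "v \<in> A y" "v \<in> A z"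
      using v unfolding struct_def by blast
    then show False
    proof cases
      case 1
      then show False using d by blast
    next
      case 2
      then show False using tip_if_C[OF r] d by blast
    next
      case 3
      then show False using tip_if_C[OF p] d by blast
    next
      case 4
      then have "y = z" using A_disj by blast
      then show False using 4 d by blast
    qed
  qed
  then show ?thesis by blast
qed

lemma U_struct: "u \<in> U b \<Longrightarrow> p \<in> L \<Longrightarrow> u \<notin> struct p"
proof
  assume u: "u \<in> U b" and p: "p \<in> L" and s: "u \<in> struct p"
  have nc: "u \<notin> set p" using u p by (auto simp: U_def covered_def)
  then obtain z where z: "z \<in> ZZ" "tip z \<in> set p" "u \<in> A z" using s by (auto simp: struct_def)
  obtain y where y: "y \<in> ZZ" "u = tip y" using u Z_ZZ by (auto simp: U_def X_def)
  then have "z = y" using tip_eq[of y u z] z by simp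
  then show False using z y nc by simp
qed

text \<open>After deleting fewer than \<open>k\<close> vertices one of the \<open>k\<close> disjoint
  structures is intact. Every remaining vertex reaches the head of its walk, the walk leads to its
  last vertex, and by the reversed argument every remaining vertex is reached from there.\<close>

lemma class_connected:
  assumes W: "W \<subseteq> V" and K: "K \<subseteq> L" "card K = k" "\<And>p. p \<in> K \<Longrightarrow> struct p \<subseteq> W"
    and N: "\<And>b. N b \<subseteq> U b \<inter> W \<and> card (N b) = k"
    and R: "\<And>w b. w \<in> W \<Longrightarrow> w \<in> Q b \<Longrightarrow>
      \<exists>R\<subseteq>W. card R = k \<and> (\<forall>u\<in>R. u \<notin> C \<and> dir E b w u \<and> (w \<notin> ZZ \<longrightarrow> u \<notin> Bad b))"
  shows "strongly_k_connected W E (real k)"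
proof -
  have finW: "finite W" using W finV finite_subset by blast
  define rank :: "bool \<Rightarrow> 'a \<Rightarrow> nat" where
    "rank = (\<lambda>b w. if w \<notin> Bad b then 0 else if w \<notin> Q b then 2 else if w \<in> ZZ then 3 else 1)"
  have to_tip: "reach (W - S) (dir E b) w (hd (orient b p))"
    if S: "S \<subseteq> W" "card S < k" and p: "p \<in> K" "struct p \<inter> S = {}" and w: "w \<in> W - S" for S p w b
  proof -
    have pL: "p \<in> L" using p K by blast
    obtain z where z: "z \<in> Z b" "hd (orient b p) = tip z" using head_in_X[OF pL, of b] by (auto simp: X_def)
    have "tip z \<in> set p" using head_in_X[OF pL, of b] z by simp
    then have Az: "A z \<subseteq> struct p" using Z_ZZ[OF z(1)] by (auto simp: struct_def)
    have "reach (W - S) (dir E b) w (tip z)"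
    proof (rule robust_reach[where rank = "rank b" and A = "A z" and k = k])
      show "finite S" using S finW finite_subset by blast
      show "card S < k" by (rule S)
      show "A z \<subseteq> W - S" using Az K(3)[OF p(1)] p(2) by blast
      show "reach (A z) (dir E b) v (tip z)" if "v \<in> A z" for v using A_reach[OF z(1) that] .
      show "w \<in> W - S" by (rule w)
    next
      fix v assume "v \<in> W" "rank b v = 0"
      then have "v \<notin> Bad b" "v \<in> V" using W by (auto simp: rank_def split: if_splits)
      then show "\<exists>u\<in>A z. dir E b v u" using z(1) by (auto simp: Bad_def)
    next
      fix v assume v: "v \<in> W" "0 < rank b v"
      then have bad: "v \<in> Bad b" and vV: "v \<in> V" using W by (auto simp: rank_def split: if_splits)
      show "\<exists>R\<subseteq>W. card R = k \<and> (\<forall>u\<in>R. dir E b v u \<and> rank b u < rank b v)"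
      proof (cases "v \<in> Q b")
        case True
        obtain R where R: "R \<subseteq> W" "card R = k"
          "\<forall>u\<in>R. u \<notin> C \<and> dir E b v u \<and> (v \<notin> ZZ \<longrightarrow> u \<notin> Bad b)"
          using R[OF v(1) True] by blast
        have "rank b u < rank b v" if "u \<in> R" for u
          using R(3) that True bad ZZ_C by (auto simp: rank_def)
        then show ?thesis using R by blast
      next
        case False
        have "dir E b v u \<and> rank b u < rank b v" if u: "u \<in> N b" for u
        proof
          have uU: "u \<in> U b" using N[of b] u by blast
          have "v \<noteq> u" using False U_Q uU by blast
          moreover have "\<not> dir E b u v" using False bad uU by (auto simp: Q_def)
          ultimately show "dir E b v u"
            using tournament_dir[OF tour, of b] vV U_V[of b] uU by (auto simp: tournament_def)
          have "u \<in> Q b" "u \<notin> ZZ" using uU U_Q U_ZZ by blast+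
          then show "rank b u < rank b v" using False bad by (auto simp: rank_def Q_def)
        qed
        then show ?thesis using N[of b] by (intro exI[of _ "N b"]) auto
      qed
    qed
    then show ?thesis using z(2) by simp
  qed
  have finK: "finite K" using K finL finite_subset by blast
  \<comment> \<open>The heads of the \<open>k\<close> walks are distinct, and the last vertex of one
    walk supplies the extra vertex for the strict bound, as tips of the two orientations
    differ.\<close>
  have "real k < real (card W)"
  proof -
    have "K \<noteq> {}" using K(2) k by auto
    then obtain p where p: "p \<in> K" by blast
    have X: "hd r \<in> X True \<and> hd r \<in> set r \<and> last r \<in> X False \<and> last r \<in> set r" if "r \<in> K" for r
      using walk_L[of r] K(1) that by auto
    have "inj_on hd K"
    proof (rule inj_onI)
      fix r s assume "r \<in> K" "s \<in> K" "hd r = hd s"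
      then have "hd r \<in> set r \<inter> set s" "r \<in> L" "s \<in> L" using X[of r] X[of s] K(1) by auto
      then show "r = s" using L_disj by blast
    qed
    then have "card (hd ` K) = k" using K(2) by (simp add: card_image)
    moreover have "last p \<notin> hd ` K"
    proof
      assume "last p \<in> hd ` K"
      then obtain r where "r \<in> K" "last p = hd r" by blast
      then show False using X[OF p] X[of r] X_disj by auto
    qed
    moreover have "insert (last p) (hd ` K) \<subseteq> W" using X K(3) p by (auto simp: struct_def)
    ultimately have "Suc k \<le> card W"
      using card_mono[OF finW, of "insert (last p) (hd ` K)"] finK by simp
    then show ?thesis by simp
  qed
  moreover have "strongly_connected (W - S) E" if S: "S \<subseteq> W" "real (card S) < real k" for S
    unfolding strongly_connected_def
  proof (intro ballI)
    fix u v assume u: "u \<in> W - S" and v: "v \<in> W - S"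
    have finS: "finite S" using S finW finite_subset by blast
    have "card {p\<in>K. struct p \<inter> S \<noteq> {}} \<le> card S"
      by (rule card_meeting_le[OF finK finS]) (use struct_disj K(1) in blast)
    then have "{p\<in>K. struct p \<inter> S \<noteq> {}} \<noteq> K" using S(2) K(2) by auto
    then obtain p where p: "p \<in> K" "struct p \<inter> S = {}" by blast
    then have pL: "p \<in> L" using K by blast
    have cS: "card S < k" using S(2) by simp
    have "reach (W - S) E u (hd p)"
      using to_tip[OF S(1) cS p u, of True] by (simp add: dir_def orient_def)
    moreover have "reach (W - S) E (hd p) (last p)"
    proof (rule reach_walk)
      show "walk E p" using walk_L(1)[OF pL] by (rule walk_mono) (simp add: induced_arcs_def)
      show "set p \<subseteq> W - S" using K(3)[OF p(1)] p(2) by (auto simp: struct_def)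
    qed
    moreover have "reach (W - S) E (last p) v"
      using to_tip[OF S(1) cS p v, of False] walk_L(4)[OF pL]
      by (simp add: dir_def orient_def hd_rev reach_converse[of _ E])
    ultimately show "reach (W - S) E u v" by (meson rtranclp_trans)
  qed
  ultimately show ?thesis by (simp add: strongly_k_connected_def)
qed

lemma classes:
  "\<exists>f. (\<forall>v. f v \<in> {1..t}) \<and> (\<forall>i\<in>{1..t}. strongly_k_connected {v\<in>V. f v = i} E (real k))"
proof -
  obtain R0 where R0: "\<forall>r\<in>Req. R0 r \<subseteq> cand r \<and> finite (R0 r) \<and> card (R0 r) = k"
    and R0_disj: "\<forall>r\<in>Req. \<forall>s\<in>Req. r \<noteq> s \<longrightarrow> R0 r \<inter> R0 s = {}"
    by (rule representatives)
  define R where "R = (\<lambda>w. \<Union>b\<in>{b. w \<in> Q b}. R0 (w, b))"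
  have R0c: "R0 (w, b) \<subseteq> cand (w, b) \<and> finite (R0 (w, b)) \<and> card (R0 (w, b)) = k" if "w \<in> Q b" for w b
    using R0 that by (simp add: Req_def)
  have R_avoid: "u \<notin> C \<and> u \<notin> Sp \<and> (w \<notin> Sp \<longrightarrow> u \<notin> covered)" if "u \<in> R w" for u w
    using that R0c by (fastforce simp: R_def cand_def avoid_def)
  have R_req: "w \<in> Q True \<or> w \<in> Q False" if "u \<in> R w" for u w
    using that by (auto simp: R_def) (metis (full_types))
  have R_disj: "v = w" if uR: "u \<in> R v" "u \<in> R w" for u v w
  proof -
    obtain b b' where b: "v \<in> Q b" "u \<in> R0 (v, b)" "w \<in> Q b'" "u \<in> R0 (w, b')"
      using uR unfolding R_def by blast
    then have "(v, b) \<in> Req" "(w, b') \<in> Req" "R0 (v, b) \<inter> R0 (w, b') \<noteq> {}"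
      by (auto simp: Req_def)
    then have "\<not> (v, b) \<noteq> (w, b')" using R0_disj[rule_format, of "(v, b)" "(w, b')"] by metis
    then show ?thesis by simp
  qed
  have fR: "finite (R w) \<and> card (R w) \<le> 2 * k" for w
  proof -
    have "R w = (\<Union>b. if w \<in> Q b then R0 (w, b) else {})" by (auto simp: R_def split: if_splits)
    also have "\<dots> = (if w \<in> Q True then R0 (w, True) else {}) \<union> (if w \<in> Q False then R0 (w, False) else {})"
      by (simp add: UNIV_bool Un_commute)
    finally have eq: "R w = (if w \<in> Q True then R0 (w, True) else {}) \<union> (if w \<in> Q False then R0 (w, False) else {})" .
    have "card (if w \<in> Q b then R0 (w, b) else {}) \<le> k" for b using R0c[of w b] by auto
    then have "card (R w) \<le> k + k" unfolding eq by (intro order_trans[OF card_Un_le] add_mono)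
    moreover have "finite (R w)" unfolding eq using R0c by auto
    ultimately show ?thesis by simp
  qed
  \<comment> \<open>A structure forces its class on \<open>w\<close> by containing \<open>w\<close>
    or a vertex reserved for \<open>w\<close>. The bound \<open>2 * k + 1\<close> counts
    \<open>w\<close> and \<open>k\<close> reserved vertices in each orientation.\<close>
  define H where "H = (\<lambda>w. {p\<in>L. struct p \<inter> insert w (R w) \<noteq> {}})"
  have card_H: "card (H w) \<le> 2 * k + 1" for w
  proof -
    have "card (H w) \<le> card (insert w (R w))"
      unfolding H_def by (rule card_meeting_le[OF finL]) (use fR struct_disj in auto)
    also have "\<dots> \<le> Suc (card (R w))" by (rule card_insert_le_m1) simp_all
    finally show ?thesis using fR[of w] by simp
  qed
  have H_ordinary: "H w = {}" if w: "w \<in> Q True \<or> w \<in> Q False" "w \<notin> Sp" for w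
  proof -
    have nc: "w \<notin> covered" using w ordinary(1) by blast
    have "w \<notin> struct p" if "p \<in> L" for p
    proof (cases "w \<in> U True \<union> U False")
      case True
      then show ?thesis using U_struct that by blast
    next
      case False
      then have "w \<notin> C" using w(2) by (auto simp: Sp_def)
      then show ?thesis using nc struct_sub[OF that] by blast
    qed
    moreover have "struct p \<inter> R w = {}" if "p \<in> L" for p
      using R_avoid w(2) struct_sub[OF that] by blast
    ultimately show ?thesis by (auto simp: H_def)
  qed
  have H_plain: "R w = {}" if "\<not> (w \<in> Q True \<or> w \<in> Q False)" for w using R_req that by blast
  obtain L0 where L0: "L0 \<subseteq> L" "card L0 = k * t" and L0_Sp: "\<forall>w\<in>Sp. card (H w \<inter> L0) \<le> 1"
  proof -
    have "\<exists>K\<subseteq>L. card K = k * t \<and> (\<forall>w\<in>Sp. card (H w \<inter> K) \<le> 1)"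
    proof (rule sparse_transversal[where h = "2 * k + 1" and g = g])
      show "H w \<subseteq> L \<and> card (H w) \<le> 2 * k + 1" for w using card_H by (auto simp: H_def)
      show "card Sp \<le> g * card L" using card_Sp g card_L by simp
      show "2 * (k * t) * Suc (2 * g * (2 * k + 1) * (2 * k + 1)) \<le> card L" using M card_L by simp
    qed (use finL finSp in auto)
    then show thesis using that by blast
  qed
  have finH: "finite (H w \<inter> L0)" for w using finL by (simp add: H_def)
  \<comment> \<open>At most one kept structure forces a class on any vertex: by sparse selection for
    exceptional vertices, by \<open>H_ordinary\<close> for other requests, and by disjointness of
    structures for vertices without requests.\<close>
  have H_one: "p = r" if "p \<in> H w \<inter> L0" "r \<in> H w \<inter> L0" for p r w
  proof -
    have "card (H w \<inter> L0) \<le> Suc 0"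
    proof (cases "w \<in> Sp")
      case True
      then show ?thesis using L0_Sp by simp
    next
      case False
      show ?thesis
      proof (cases "w \<in> Q True \<or> w \<in> Q False")
        case True
        then show ?thesis using H_ordinary False by simp
      next
        case plain: False
        have "card (H w) \<le> card (insert w (R w))"
          unfolding H_def by (rule card_meeting_le[OF finL]) (use fR struct_disj in auto)
        then have "card (H w) \<le> Suc 0" using H_plain[OF plain] by simp
        moreover have "card (H w \<inter> L0) \<le> card (H w)" using finL by (intro card_mono) (auto simp: H_def)
        ultimately show ?thesis by simp
      qed
    qed
    then show ?thesis using card_le_Suc0_iff_eq[OF finH] that by blast
  qed
  have finL0: "finite L0" using L0 finL finite_subset by blast
  obtain iL where iL: "\<forall>p\<in>L0. iL p \<in> {1..t}" "\<forall>j\<in>{1..t}. card {p\<in>L0. iL p = j} = k"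
    using equipartition[OF finL0 L0(2)] by blast
  have "\<forall>b. \<exists>i. (\<forall>u\<in>U b. i u \<in> {1..t}) \<and> (\<forall>j\<in>{1..t}. card {u\<in>U b. i u = j} = k)"
    using equipartition[OF finU card_U] by blast
  then obtain iU where iU: "\<forall>b. (\<forall>u\<in>U b. iU b u \<in> {1..t}) \<and> (\<forall>j\<in>{1..t}. card {u\<in>U b. iU b u = j} = k)"
    by (rule choice[THEN exE])
  define F where "F = {w. H w \<inter> L0 \<noteq> {}} \<union> (U True \<union> U False)"
  define \<phi> where "\<phi> = (\<lambda>w. if w \<in> U True then iU True w else if w \<in> U False then iU False w
    else iL (THE p. p \<in> H w \<inter> L0))"
  have U_H: "H u = {}" if "u \<in> U b" for u b
    using H_ordinary[of u] U_Q[of b] U_Sp that by (cases b) auto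
  have \<phi>_H: "\<phi> w = iL p" if "p \<in> H w \<inter> L0" for p w
  proof -
    have "w \<notin> U True" "w \<notin> U False" using U_H that by blast+
    moreover have "(THE p. p \<in> H w \<inter> L0) = p" using that H_one by (intro the_equality) blast+
    ultimately show ?thesis by (simp add: \<phi>_def)
  qed
  have \<phi>_U: "\<phi> u = iU b u" if "u \<in> U b" for u b
    using that U_disj by (cases b) (auto simp: \<phi>_def)
  have "\<exists>f. (\<forall>v. f v \<in> {1..t}) \<and> (\<forall>v\<in>F. f v = \<phi> v) \<and> (\<forall>w. \<forall>u\<in>R w. f u = f w)"
  proof (rule propagate_classes[OF t _ R_disj])
    fix v assume "v \<in> F"
    then consider p where "p \<in> H v \<inter> L0" | b where "v \<in> U b" by (auto simp: F_def)
    then show "\<phi> v \<in> {1..t}"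
    proof cases
      case 1
      then show ?thesis using \<phi>_H iL(1) by fastforce
    next
      case 2
      then show ?thesis using \<phi>_U iU by metis
    qed
  next
    \<comment> \<open>A reserved vertex \<open>u\<close> with a forced class is no tip and has no
      request, for otherwise \<open>H u\<close> would be empty. Hence \<open>u\<close> itself lies
      in a kept structure, which then forces the same class on its parent \<open>w\<close>.\<close>
    fix u w assume u: "u \<in> R w" "u \<in> F"
    have av: "u \<notin> C" "u \<notin> Sp" using R_avoid[OF u(1)] by auto
    have "u \<notin> U b" for b using av(1) U_X X_C by blast
    then obtain p where p: "p \<in> H u \<inter> L0" using u(2) by (auto simp: F_def)
    then have "\<not> (u \<in> Q True \<or> u \<in> Q False)" using H_ordinary av(2) by blast
    then have "R u = {}" by (rule H_plain)
    then have "u \<in> struct p" using p by (auto simp: H_def)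
    then have "p \<in> H w \<inter> L0" using u(1) p by (auto simp: H_def)
    then show "w \<in> F \<and> \<phi> u = \<phi> w" using \<phi>_H p by (auto simp: F_def)
  qed
  then obtain f where f: "\<forall>v. f v \<in> {1..t}" "\<forall>v\<in>F. f v = \<phi> v" "\<forall>w. \<forall>u\<in>R w. f u = f w" by blast
  have "strongly_k_connected {v\<in>V. f v = i} E (real k)" if i: "i \<in> {1..t}" for i
  proof (rule class_connected[where K = "{p\<in>L0. iL p = i}" and N = "\<lambda>b. {u\<in>U b. iU b u = i}"])
    show "{v\<in>V. f v = i} \<subseteq> V" by auto
    show "{p\<in>L0. iL p = i} \<subseteq> L" using L0 by auto
    show "card {p\<in>L0. iL p = i} = k" using iL(2) i by blast
  next
    fix p assume p: "p \<in> {p\<in>L0. iL p = i}"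
    show "struct p \<subseteq> {v\<in>V. f v = i}"
    proof
      fix v assume v: "v \<in> struct p"
      have "p \<in> H v \<inter> L0" using v p L0(1) by (auto simp: H_def)
      moreover from this have "v \<in> F" by (auto simp: F_def)
      ultimately have "f v = i" using f(2) \<phi>_H p by fastforce
      moreover have "v \<in> V" using struct_V[of p] p L0(1) v by blast
      ultimately show "v \<in> {v\<in>V. f v = i}" by simp
    qed
  next
    fix b
    have "u \<in> {v\<in>V. f v = i}" if "u \<in> U b" "iU b u = i" for u
    proof -
      have "u \<in> F" using that(1) by (cases b) (auto simp: F_def)
      then show ?thesis using f(2) \<phi>_U[OF that(1)] that U_V by fastforce
    qed
    then show "{u\<in>U b. iU b u = i} \<subseteq> U b \<inter> {v\<in>V. f v = i} \<and> card {u\<in>U b. iU b u = i} = k"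
      using iU i by blast
  next
    fix w b assume w: "w \<in> {v\<in>V. f v = i}" "w \<in> Q b"
    have sub: "R0 (w, b) \<subseteq> R w" using w(2) by (auto simp: R_def)
    have c: "R0 (w, b) \<subseteq> cand (w, b)" using R0c[OF w(2)] by blast
    have "R0 (w, b) \<subseteq> {v\<in>V. f v = i}"
    proof
      fix u assume u: "u \<in> R0 (w, b)"
      then have "u \<in> V" using c by (auto simp: cand_def)
      moreover have "f u = f w" using f(3) u sub by blast
      ultimately show "u \<in> {v\<in>V. f v = i}" using w(1) by simp
    qed
    moreover have "u \<notin> C \<and> dir E b w u \<and> (w \<notin> ZZ \<longrightarrow> u \<notin> Bad b)" if "u \<in> R0 (w, b)" for u
      using c that by (auto simp: cand_def avoid_def)
    ultimately show "\<exists>R\<subseteq>{v\<in>V. f v = i}. card R = k \<and>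
        (\<forall>u\<in>R. u \<notin> C \<and> dir E b w u \<and> (w \<notin> ZZ \<longrightarrow> u \<notin> Bad b))"
      using R0c[OF w(2)] by (intro exI[of _ "R0 (w, b)"]) auto
  qed
  then show ?thesis using f(1) by blast
qed

end

section \<open>Highly connected tournaments\<close>

text \<open>Deleting the out-neighbourhood of \<open>v\<close> would leave \<open>v\<close> without
  outgoing arcs although another vertex remains.\<close>

lemma outdegree_if_strongly_k_connected:
  assumes T: "tournament V E" and conn: "strongly_k_connected V E (real n)" and v: "v \<in> V"
  shows "n \<le> card {w\<in>V. E v w}"
proof (rule ccontr)
  let ?S = "{w\<in>V. E v w}"
  assume neg: "\<not> ?thesis"
  have fin: "finite V" using T by (simp add: tournament_def)
  have vS: "v \<in> V - ?S" using T v by (auto simp: tournament_def)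
  have "card V > Suc (card ?S)" using conn neg by (auto simp: strongly_k_connected_def)
  moreover have "card (V - ?S) = card V - card ?S" using fin by (intro card_Diff_subset) auto
  ultimately have "card (V - ?S) > 1" by simp
  then have "V - ?S \<noteq> {v}" by auto
  then obtain w where w: "w \<in> V - ?S" "w \<noteq> v" using vS by blast
  have "?S \<subseteq> V" "real (card ?S) < real n" using neg by auto
  then have "strongly_connected (V - ?S) E" using conn unfolding strongly_k_connected_def by blast
  then have "reach (V - ?S) E v w" using vS w unfolding strongly_connected_def by blast
  then show False using w(2) by (cases rule: converse_rtranclpE) (auto simp: induced_arcs_def)
qed

lemma strongly_connected_converse: "strongly_connected U (\<lambda>x y. E y x) \<longleftrightarrow> strongly_connected U E"
  unfolding strongly_connected_def reach_converse[of U E] by blast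

lemma strongly_k_connected_dir: "strongly_k_connected U (dir E b) c \<longleftrightarrow> strongly_k_connected U E c"
  by (cases b) (simp_all add: strongly_k_connected_def dir_def strongly_connected_converse[of _ E])

lemma strongly_k_connected_antimono:
  "strongly_k_connected V E a \<Longrightarrow> b \<le> a \<Longrightarrow> strongly_k_connected V E b"
  by (auto simp: strongly_k_connected_def)

theorem tournament_partition:
  fixes V :: "'a set" and k t c g M m n q :: nat
  assumes T: "tournament V E" and conn: "strongly_k_connected V E (real n)"
    and k: "1 \<le> k" and t: "1 \<le> t"
    and m: "m = M + k * t" and q: "q = 2 * m * (c + 2)"
    and pow: "16 * k * m \<le> 2 ^ c" and n: "16 * k * q \<le> n"
    and g: "q + 4 * M \<le> g * M"
    and M: "2 * (k * t) * Suc (2 * g * (2 * k + 1) * (2 * k + 1)) \<le> M"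
  shows "\<exists>f. (\<forall>v. f v \<in> {1..t}) \<and> (\<forall>i\<in>{1..t}. strongly_k_connected {v\<in>V. f v = i} E (real k))"
proof -
  have fin: "finite V" using T by (simp add: tournament_def)
  have Td: "tournament V (dir E b)" for b using T by (rule tournament_dir)
  have deg: "n \<le> card {w\<in>V. dir E b v w}" if "v \<in> V" for v b
    by (rule outdegree_if_strongly_k_connected[OF Td _ that])
      (simp add: strongly_k_connected_dir conn)
  have m1: "1 \<le> m" using mult_le_mono[OF k t] unfolding m by linarith
  have q4: "4 * m \<le> q" by (simp add: q)
  have qn: "16 * q \<le> n"
  proof -
    have "1 * (16 * q) \<le> k * (16 * q)" using k by (rule mult_le_mono1)
    also have "\<dots> = 16 * k * q" by simp
    finally show ?thesis using n by linarith
  qed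
  have cV: "n < card V" using conn by (simp add: strongly_k_connected_def)
  have "m \<le> card V" using q4 qn cV by linarith
  then have "\<exists>Z d. Z \<subseteq> V \<and> card Z = m \<and> n \<le> d \<and>
      (\<forall>z\<in>Z. card {w\<in>V. dir E True z w} \<le> d) \<and> (\<forall>w\<in>V - Z. d \<le> card {v\<in>V. dir E True w v})"
    using fin deg by (intro lowest_subset)
  then obtain Z1 d1 where Z1: "Z1 \<subseteq> V" "card Z1 = m" "n \<le> d1"
    "\<forall>z\<in>Z1. card {w\<in>V. dir E True z w} \<le> d1" "\<forall>w\<in>V - Z1. d1 \<le> card {v\<in>V. dir E True w v}"
    by (elim exE conjE) (rule that)
  have finZ1: "finite Z1" using Z1(1) fin finite_subset by blast
  \<comment> \<open>The second set is taken from the complement of the first to keep them disjoint;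
    its threshold therefore bounds degrees only outside both sets.\<close>
  have "m \<le> card (V - Z1)"
    using card_Diff_subset[OF finZ1 Z1(1)] Z1(2) q4 qn cV by linarith
  moreover have "finite (V - Z1)" using fin by simp
  moreover have "n \<le> card {w\<in>V. dir E False v w}" if "v \<in> V - Z1" for v using deg that by blast
  ultimately have "\<exists>Z d. Z \<subseteq> V - Z1 \<and> card Z = m \<and> n \<le> d \<and>
      (\<forall>z\<in>Z. card {w\<in>V. dir E False z w} \<le> d) \<and> (\<forall>w\<in>(V - Z1) - Z. d \<le> card {v\<in>V. dir E False w v})"
    by (intro lowest_subset)
  then obtain Z2 d2 where Z2: "Z2 \<subseteq> V - Z1" "card Z2 = m" "n \<le> d2"
    "\<forall>z\<in>Z2. card {w\<in>V. dir E False z w} \<le> d2" "\<forall>w\<in>(V - Z1) - Z2. d2 \<le> card {v\<in>V. dir E False w v}"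
    by (elim exE conjE) (rule that)
  have finZ2: "finite Z2" using Z2(1) fin finite_subset by blast
  define Z where "Z = (\<lambda>b. if b then Z1 else Z2)"
  define d where "d = (\<lambda>b. if b then d1 else d2)"
  let ?ZZ = "Z True \<union> Z False"
  have ZV: "Z b \<subseteq> V" "card (Z b) = m" "finite (Z b)" for b
    using Z1 Z2 finZ1 finZ2 by (auto simp: Z_def)
  have Zdisj: "Z True \<inter> Z False = {}" using Z2(1) by (auto simp: Z_def)
  \<comment> \<open>Membership in \<open>Z1\<close> determines the orientation, so one application
    of \<open>chain_family\<close> yields both kinds of chains.\<close>
  have dir_Z: "dir E (z \<in> Z1) = dir E b" if "z \<in> Z b" for z b
    using that Z2(1) by (cases b) (auto simp: Z_def)
  have deg_Z: "card {w\<in>V. dir E b z w} \<le> d b" if "z \<in> Z b" for z b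
    using that Z1(4) Z2(4) by (cases b) (auto simp: Z_def d_def)
  have cZZ: "card ?ZZ = 2 * m" using card_Un_disjoint[OF ZV(3) ZV(3) Zdisj] ZV(2) by simp
  have "card ?ZZ * (c + 3) < n"
  proof -
    have "card ?ZZ * (c + 3) = q + 2 * m" by (simp add: cZZ q algebra_simps)
    then show ?thesis using q4 qn m1 by linarith
  qed
  then have degZ: "card ?ZZ * (c + 3) < card {w\<in>V. dir E (z \<in> Z1) z w}" if "z \<in> ?ZZ" for z
    using deg[of z "z \<in> Z1"] that ZV(1) by fastforce
  have "\<exists>A tip. (\<forall>z\<in>?ZZ. A z \<subseteq> V \<and> card (A z) \<le> c + 2 \<and> z \<in> A z \<and> tip z \<in> A z \<and> tip z \<noteq> z \<and>
      (\<forall>v\<in>A z. reach (A z) (dir E (z \<in> Z1)) v (tip z)) \<and>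
      card {w\<in>V - \<Union>(A ` ?ZZ). \<forall>v\<in>A z. \<not> dir E (z \<in> Z1) w v} * 2 ^ c \<le> card {w\<in>V. dir E (z \<in> Z1) z w}) \<and>
    (\<forall>z\<in>?ZZ. \<forall>y\<in>?ZZ. z \<noteq> y \<longrightarrow> A z \<inter> A y = {})" (is "\<exists>A tip. ?P A tip")
  proof (rule chain_family)
    show "finite ?ZZ" "?ZZ \<subseteq> V" using ZV by auto
  qed (rule Td, erule degZ)
  then obtain A tip where At: "?P A tip" by (elim exE) (rule that)
  note A = bspec[OF conjunct1[OF At]]
  have A_disj: "A y \<inter> A z = {}" if "y \<in> ?ZZ" "z \<in> ?ZZ" "y \<noteq> z" for y z
    using conjunct2[OF At] that by blast
  define X where "X = (\<lambda>b. tip ` Z b)"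
  define C where "C = \<Union>(A ` ?ZZ)"
  define V' where "V' = V - (C - (X True \<union> X False))"
  have cX: "card (X b) = m" "finite (X b)" for b
  proof -
    have "inj_on tip (Z b)"
    proof (rule inj_onI)
      fix y z assume yz: "y \<in> Z b" "z \<in> Z b" "tip y = tip z"
      have yz': "y \<in> ?ZZ" "z \<in> ?ZZ" using yz(1,2) by (cases b; simp)+
      have "tip y \<in> A y" using A[OF yz'(1)] by (elim conjE)
      moreover have "tip y \<in> A z" unfolding yz(3) using A[OF yz'(2)] by (elim conjE)
      ultimately show "y = z" using A_disj[OF yz'] by fast
    qed
    then show "card (X b) = m" using ZV(2) by (simp add: X_def card_image)
    show "finite (X b)" using ZV(3) by (simp add: X_def)
  qed
  have C_V: "C \<subseteq> V" unfolding C_def using A by blast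
  have XC: "X b \<subseteq> C" for b
  proof
    fix x assume "x \<in> X b"
    then obtain z where z: "z \<in> Z b" "x = tip z" by (auto simp: X_def)
    then have "z \<in> ?ZZ" by (cases b) auto
    then show "x \<in> C" using A[of z] z(2) unfolding C_def by blast
  qed
  have cC: "card C \<le> q"
  proof -
    have "card C \<le> (\<Sum>z\<in>?ZZ. card (A z))" unfolding C_def using ZV(3) by (intro card_UN_le) auto
    also have "\<dots> \<le> card ?ZZ * (c + 2)" using sum_bounded_above[of ?ZZ "\<lambda>z. card (A z)" "c + 2"] A by simp
    finally show ?thesis by (simp add: cZZ q)
  qed
  have Mm: "M \<le> m" by (simp add: m)
  let ?G = "{(x, y). induced_arcs V' E x y}"
  have Geq: "(\<lambda>x y. (x, y) \<in> ?G) = induced_arcs V' E" by simp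
  have "\<exists>L. linkage (\<lambda>x y. (x, y) \<in> ?G) (X True) (X False) L \<and> card L = M"
  proof (rule menger)
    have "?G \<subseteq> V \<times> V" by (auto simp: induced_arcs_def V'_def)
    then show "finite ?G" using fin finite_subset by blast
    fix S :: "'a set" assume S: "finite S" "card S < M"
    have ex: "\<exists>x\<in>X b. x \<notin> S" for b
    proof (rule ccontr)
      assume "\<not> ?thesis"
      then have "X b \<subseteq> S" by blast
      then have "card (X b) \<le> card S" by (rule card_mono[OF S(1)])
      then show False using cX(1)[of b] S(2) Mm by linarith
    qed
    obtain x where x: "x \<in> X True" "x \<notin> S" using ex[of True] by blast
    obtain y where y: "y \<in> X False" "y \<notin> S" using ex[of False] by blast
    \<comment> \<open>Restricting to \<open>V'\<close> and removing \<open>S\<close> deletes fewer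
      than \<open>q + M\<close> vertices of the tournament, which is below \<open>n\<close>, so
      strong connectivity persists.\<close>
    let ?D = "(C - (X True \<union> X False)) \<union> (S \<inter> V)"
    have "card ?D \<le> card (C - (X True \<union> X False)) + card (S \<inter> V)" by (rule card_Un_le)
    also have "\<dots> \<le> card C + card S"
      using finite_subset[OF C_V fin] S(1) by (intro add_mono card_mono) auto
    finally have "card ?D < n" using cC S(2) Mm q4 qn by linarith
    moreover have "?D \<subseteq> V" using C_V by blast
    ultimately have "strongly_connected (V - ?D) E" using conn by (simp add: strongly_k_connected_def)
    moreover have "V - ?D = V' - S" by (auto simp: V'_def)
    moreover have xV: "x \<in> V' - S" and "y \<in> V' - S"
      using x y XC[of True] XC[of False] C_V by (auto simp: V'_def)
    ultimately have "reach (V' - S) E x y" by (simp add: strongly_connected_def)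
    then obtain p where p: "walk E p" "hd p = x" "last p = y" "set p \<subseteq> V' - S"
      using walk_if_reach[OF _ xV] by blast
    have "walk (induced_arcs V' E) p" using p(1)
      by (rule walk_mono) (use p(4) in \<open>auto simp: induced_arcs_def\<close>)
    then show "\<exists>p. walk (\<lambda>x y. (x, y) \<in> ?G) p \<and> hd p \<in> X True \<and> last p \<in> X False \<and> set p \<inter> S = {}"
      unfolding Geq using p x(1) y(1) by blast
  qed (use cX in auto)
  then obtain L where L: "shortest_linkage (induced_arcs V' E) (X True) (X False) L" "card L = M"
    unfolding Geq using shortest_linkage_exists by metis
  interpret linked_tournament V E k t c g M m n q Z d A tip L ?ZZ C X V'
  proof unfold_locales
    show "?ZZ \<equiv> Z True \<union> Z False" by simp
    show "C \<equiv> \<Union>(A ` ?ZZ)" unfolding C_def .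
    show "X \<equiv> \<lambda>b. tip ` Z b" unfolding X_def .
    show "V' \<equiv> V - (C - (X True \<union> X False))" unfolding V'_def .
    show "reach (A z) (dir E b) v (tip z)" if "z \<in> Z b" "v \<in> A z" for z b v
    proof -
      have "z \<in> ?ZZ" using that(1) by (cases b) auto
      then show ?thesis using A[of z] that dir_Z[OF that(1)] by auto
    qed
    show "card {w\<in>V - \<Union>(A ` ?ZZ). \<forall>v\<in>A z. \<not> dir E b w v} * 2 ^ c \<le> d b" if "z \<in> Z b" for z b
    proof -
      have "z \<in> ?ZZ" using that(1) by (cases b) auto
      then have "card {w\<in>V - \<Union>(A ` ?ZZ). \<forall>v\<in>A z. \<not> dir E b w v} * 2 ^ c \<le> card {w\<in>V. dir E b z w}"
        using A[of z] dir_Z[OF that] by auto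
      then show ?thesis using deg_Z[OF that] by simp
    qed
    show "d b \<le> card {w\<in>V. dir E b v w}" if "v \<in> V - ?ZZ" for v b
      using that Z1(5) Z2(5) by (cases b) (auto simp: Z_def d_def)
    show "n \<le> d b" for b using Z1(3) Z2(3) by (simp add: d_def)
    show "A y \<inter> A z = {}" if "y \<in> ?ZZ" "z \<in> ?ZZ" "y \<noteq> z" for y z using A_disj that .
    show "A z \<subseteq> V \<and> card (A z) \<le> c + 2 \<and> z \<in> A z \<and> tip z \<in> A z \<and> tip z \<noteq> z" if "z \<in> ?ZZ" for z
      using A[OF that] by blast
    show "n \<le> card {w\<in>V. dir E b v w}" if "v \<in> V" for v b using deg that .
    show "shortest_linkage (induced_arcs (V - (\<Union>(A ` ?ZZ) - (tip ` Z True \<union> tip ` Z False))) E)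
        (tip ` Z True) (tip ` Z False) L"
      using L(1) unfolding V'_def C_def X_def .
  qed (fact T k t m q pow n g M ZV(1,2) Zdisj L(2))+
  show ?thesis by (rule classes)
qed

theorem theorem1p2:
  fixes V :: "'a set" and E :: "'a \<Rightarrow> 'a \<Rightarrow> bool" and k t :: nat
  assumes "tournament V E"
    and "k \<ge> 1" and "t \<ge> 2"
    and "strongly_k_connected V E (10^7 * real k ^ 6 * real t ^ 3 * log 2 (real k * real t ^ 2))"
  shows "\<exists>P :: nat \<Rightarrow> 'a set.
           (\<Union>i\<in>{1..t}. P i) = V \<and>
           (\<forall>i\<in>{1..t}. \<forall>j\<in>{1..t}. i \<noteq> j \<longrightarrow> P i \<inter> P j = {}) \<and>
           (\<forall>i\<in>{1..t}. strongly_k_connected (P i) E (real k))"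
proof -
  define x where "x = k * t ^ 2"
  define lg where "lg = log 2 (real x)"
  define s where "s = nat \<lceil>lg\<rceil>"
  have kt: "1 \<le> k" "2 \<le> t" using assms by auto
  have x4: "4 \<le> x"
  proof -
    have "2 ^ 2 \<le> t ^ 2" using kt(2) by (intro power_mono) auto
    then have "1 * 4 \<le> k * t ^ 2" using kt(1) by (intro mult_le_mono) auto
    then show ?thesis by (simp add: x_def)
  qed
  have l2: "2 \<le> lg" using x4 by (simp add: lg_def le_log_iff)
  have ls: "lg \<le> real s" "real s \<le> lg + 1" using l2 unfolding s_def by linarith+
  have s2: "2 \<le> s" using l2 ls by linarith
  have xs: "x \<le> 2 ^ s"
  proof -
    have "real x = 2 powr lg" using x4 by (simp add: lg_def)
    also have "\<dots> \<le> 2 powr (real s)" using ls by (intro powr_mono) auto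
    also have "\<dots> = real (2 ^ s)" by (simp add: powr_realpow)
    finally show ?thesis by linarith
  qed
  \<comment> \<open>\<open>m\<close> is linear in \<open>c\<close>, so the fifth copy of \<open>s\<close> pays for the factor \<open>c\<close> in \<open>16 * k * m \<le> 2 ^ c\<close>.\<close>
  define c where "c = 5 * s + 7"
  \<comment> \<open>From \<open>m \<le> 2 * M\<close> follows
    \<open>q \<le> 4 * M * (c + 2)\<close>; adding \<open>4 * M\<close> gives
    \<open>(4 * c + 12) * M\<close>. The next definition takes the smallest \<open>M\<close>
    allowed.\<close>
  define g where "g = 4 * c + 12"
  define M where "M = 2 * (k * t) * Suc (2 * g * (2 * k + 1) * (2 * k + 1))"
  define m where "m = M + k * t"
  define q where "q = 2 * m * (c + 2)"
  have m_le: "m \<le> (36 * g + 3) * (k ^ 3 * t)"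
  proof -
    have "(2 * k + 1) * (2 * k + 1) \<le> (3 * k) * (3 * k)" using kt(1) by (intro mult_le_mono) auto
    then have "g * ((2 * k + 1) * (2 * k + 1)) \<le> g * ((3 * k) * (3 * k))" by (rule mult_le_mono2)
    moreover have "1 \<le> k * k" using kt(1) by (simp add: Suc_le_eq)
    ultimately have "4 * (g * ((2 * k + 1) * (2 * k + 1))) + 3 \<le> 36 * (g * (k * k)) + 3 * (k * k)"
      by (simp only: mult_ac)
    then have "(k * t) * (4 * (g * ((2 * k + 1) * (2 * k + 1))) + 3) \<le> (k * t) * (36 * (g * (k * k)) + 3 * (k * k))"
      by (rule mult_le_mono2)
    moreover have "m = (k * t) * (4 * (g * ((2 * k + 1) * (2 * k + 1))) + 3)"
      by (simp add: m_def M_def algebra_simps)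
    moreover have "(k * t) * (36 * (g * (k * k)) + 3 * (k * k)) = (36 * g + 3) * (k ^ 3 * t)"
      by (simp add: algebra_simps power3_eq_cube)
    ultimately show ?thesis by simp
  qed
  have g_eq: "36 * g + 3 = 720 * s + 1443" by (simp add: g_def c_def)
  have kM: "k * t \<le> M" by (simp add: M_def)
  have pow: "16 * k * m \<le> 2 ^ c"
  proof -
    have "16 * k * m \<le> 16 * k * ((36 * g + 3) * (k ^ 3 * t))" using m_le by (rule mult_le_mono2)
    also have "\<dots> = (720 * s + 1443) * (16 * (k ^ 4 * t))"
      unfolding g_eq by (simp add: algebra_simps power4_eq_xxxx power3_eq_cube)
    also have "\<dots> \<le> (8 * (128 * 2 ^ s)) * (16 * (k ^ 4 * t))"
    proof (rule mult_le_mono1)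
      show "720 * s + 1443 \<le> 8 * (128 * 2 ^ s)"
        using s2
      proof (induction s rule: nat_induct_at_least)
        case (Suc s)
        then show ?case by simp
      qed simp
    qed
    also have "\<dots> = 2 ^ 7 * 2 ^ s * (128 * (k ^ 4 * t))" by simp
    \<comment> \<open>The factor 128 is absorbed by \<open>t ^ 7\<close>, which completes
      \<open>k ^ 4 * t\<close> to \<open>x ^ 4\<close>; the remaining \<open>2 ^ 7\<close> is the 7
      in \<open>c\<close>.\<close>
    also have "\<dots> \<le> 2 ^ 7 * 2 ^ s * x ^ 4"
    proof (rule mult_le_mono2)
      have "2 ^ 7 \<le> t ^ 7" using kt(2) by (intro power_mono) auto
      then have "k ^ 4 * t * 2 ^ 7 \<le> k ^ 4 * t * t ^ 7" by (rule mult_le_mono2)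
      also have "\<dots> = x ^ 4" by (simp add: x_def power_mult_distrib flip: power_mult power_Suc)
      finally show "128 * (k ^ 4 * t) \<le> x ^ 4" by (simp add: mult_ac)
    qed
    also have "\<dots> \<le> 2 ^ 7 * 2 ^ s * (2 ^ s) ^ 4" using xs by (intro mult_le_mono2 power_mono) auto
    also have "\<dots> = 2 ^ c" by (simp add: c_def power_add flip: power_mult) (simp flip: power_add)
    finally show ?thesis .
  qed
  have gM: "q + 4 * M \<le> g * M"
  proof -
    have "m \<le> 2 * M" using kM by (simp add: m_def)
    then have "q \<le> 2 * (2 * M) * (c + 2)" unfolding q_def by (intro mult_le_mono) auto
    moreover have "g * M = 2 * (2 * M) * (c + 2) + 4 * M" by (simp add: g_def algebra_simps)
    ultimately show ?thesis by simp
  qed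
  have bound: "real (16 * k * q) \<le> 10^7 * real k ^ 6 * real t ^ 3 * log 2 (real k * real t ^ 2)"
  proof -
    \<comment> \<open>As \<open>s \<ge> 2\<close>, both affine terms become multiples of
      \<open>s\<close>: \<open>720 * s + 1443 \<le> 1442 * s\<close> and
      \<open>5 * s + 9 \<le> 10 * s\<close>.\<close>
    have "q \<le> 2 * ((1442 * s) * (k ^ 3 * t)) * (10 * s)"
      unfolding q_def
    proof (intro mult_le_mono order_refl)
      have "36 * g + 3 \<le> 1442 * s" unfolding g_eq using s2 by simp
      then have "(36 * g + 3) * (k ^ 3 * t) \<le> (1442 * s) * (k ^ 3 * t)" by (rule mult_le_mono1)
      then show "m \<le> (1442 * s) * (k ^ 3 * t)" by (rule le_trans[OF m_le])
      show "c + 2 \<le> 10 * s" using s2 by (simp add: c_def)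
    qed
    then have "16 * k * q \<le> 16 * k * (2 * ((1442 * s) * (k ^ 3 * t)) * (10 * s))" by (rule mult_le_mono2)
    also have "\<dots> = 461440 * (k ^ 4 * t) * (s * s)" by (simp add: algebra_simps power4_eq_xxxx power3_eq_cube)
    finally have 1: "real (16 * k * q) \<le> 461440 * (real k ^ 4 * real t) * (real s * real s)"
      by (metis (mono_tags, opaque_lifting) of_nat_le_iff of_nat_mult of_nat_numeral of_nat_power)
    have s1: "real s \<le> 2 * lg" using ls l2 by linarith
    \<comment> \<open>One of the two factors \<open>s\<close> is sacrificed to \<open>2 * x\<close>,
      so that the bound is linear in the logarithm.\<close>
    have "lg \<le> real x" using x4 log2_of_power_less less_exp[of x] unfolding lg_def
      by (simp add: log_le_iff powr_realpow less_imp_le)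
    then have "real s * real s \<le> (2 * lg) * (2 * real x)" using s1 l2 by (intro mult_mono) auto
    then have "461440 * (real k ^ 4 * real t) * (real s * real s)
        \<le> 461440 * (real k ^ 4 * real t) * ((2 * lg) * (2 * real x))" by (intro mult_left_mono) auto
    also have "\<dots> = 1845760 * (real k ^ 5 * real t ^ 3 * lg)"
      by (simp add: x_def algebra_simps power_numeral_reduce)
    also have "\<dots> \<le> 10^7 * (real k ^ 6 * real t ^ 3 * lg)"
      using kt l2 by (intro mult_mono mult_nonneg_nonneg power_increasing) auto
    finally show ?thesis using 1 by (simp add: lg_def x_def mult.assoc)
  qed
  have conn: "strongly_k_connected V E (real (16 * k * q))"
    using assms(4) bound by (rule strongly_k_connected_antimono)
  have "\<exists>f. (\<forall>v. f v \<in> {1..t}) \<and> (\<forall>i\<in>{1..t}. strongly_k_connected {v\<in>V. f v = i} E (real k))"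
    by (rule tournament_partition[OF assms(1) conn kt(1) _ m_def q_def pow order_refl gM])
      (use kt in \<open>simp_all add: M_def\<close>)
  then obtain f where f: "\<forall>v. f v \<in> {1..t}"
    "\<forall>i\<in>{1..t}. strongly_k_connected {v\<in>V. f v = i} E (real k)" by blast
  show ?thesis
    by (rule exI[of _ "\<lambda>i. {v\<in>V. f v = i}"]) (use f in auto)
qed

end
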